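(* Assume Setting A, that $\bar{\mathbf I}(\lambda^\circ)$ is positive definite, and that $E\|D_\lambda\log p_k^*(X_k;\lambda^\circ)\|^2<\infty$ and $E\|D^2_{\lambda\lambda}\log p_k^*(X_k;\lambda^\circ)\|<\infty$ for all $k$. Let $\hat\lambda^{(n)}=(\hat\theta^{(n)},\hat\gamma^{*(n)})$ be measurable estimators satisfying (N1) $n^{-1/2}D_\lambda\ell^{(n)}(\hat\lambda^{(n)})\to\mathbf 0$ in probability; (N2) $\hat\lambda^{(n)}\to\lambda^\circ$ in probability; (N3) $\frac1n\int_0^1\mathbf J^{(n)}(\lambda^\circ+t[\hat\lambda^{(n)}-\lambda^\circ])\,dt\to\bar{\mathbf I}(\lambda^\circ)$ in probability. Then, as $n\to\infty$, (a) $\sqrt n[\hat\lambda^{(n)}-\lambda^\circ]\to N\big(\mathbf 0,\ \bar{\mathbf I}^{-1}(\lambda^\circ)\bar{\boldsymbol\Sigma}(\lambda^\circ)\bar{\mathbf I}^{-1}(\lambda^\circ)\big)$ in distribution; (b) $\sqrt n[\hat\theta^{(n)}-\theta^\circ]\to N\big(\mathbf 0,\ [\bar{\mathbf I}^{-1}(\lambda^\circ)]_{\theta\theta}\big)$ in distribution, where $[\cdot]_{\theta\theta}$ is the upper-left $S\times S$ block.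
   Context: Setting A. Let $(\Omega_X,\mathcal B_X)$, $(\Omega_Y,\mathcal B_Y)$ be measurable spaces with a $\sigma$-finite measure $\nu_X$ on $\Omega_X$. Fix $K\ge1$, distinct $y_0,\dots,y_K\in\Omega_Y$, $S\ge1$, and for $\theta\in\mathbb R^S$ and $k=0,\dots,K$ measurable functions $x\mapsto\psi_\theta(x,y_k)$ on $\Omega_X$ with $\psi_\theta(x,y_0)=0$, such that $\theta\mapsto\psi_\theta(x,y_k)$ is three times continuously differentiable for every $x$. Let $\theta^\circ\in\mathbb R^S$ (true parameter) and for each $k$ let $f_k$ be an everywhere positive probability density on $\Omega_X$ w.r.t. $\nu_X$ of the form $\log f_k(x)=\beta(x)+\psi_{\theta^\circ}(x,y_k)-\varepsilon_k$ with a measurable $\beta$ and constants $\varepsilon_k$ (these are the conditional densities of $X$ given $Y=y_k$ under the association model with log-odds ratio $\psi_{\theta^\circ}$). $X_k$ denotes a random element with density $f_k$. Fix $\bar r_0,\dots,\bar r_K>0$ with $\sum_k\bar r_k=1$. On a common probability space let $(X_{ki})_{i\ge1}$, $k=0,\dots,K$, be independent i.i.d. sequences with $X_{ki}\sim X_k$; for $n$ in an increasing sequence with $n_k=\bar r_kn\in\mathbb N$ for all $k$, the sample is $\{X_{ki}:k=0,\dots,K,\ i\le n_k\}$. For $\lambda=(\theta,\gamma^* )\in\mathbb R^S\times\mathbb R^K$, $\gamma^*=(\gamma_1^*,\dots,\gamma_K^* )$, $\gamma_0^*:=0$, put $p_k^*(x;\lambda)=\exp(\gamma_k^*+\psi_\theta(x,y_k))/\sum_{l=0}^K\exp(\gamma_l^*+\psi_\theta(x,y_l))$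 and $\ell^{(n)}(\lambda)=\sum_{k=0}^K\sum_{i=1}^{n_k}\log p_k^*(X_{ki};\lambda)$. The true value is $\lambda^\circ=(\theta^\circ,\gamma^\circ)$ with $\gamma_k^\circ=\log\bar r_k-\varepsilon_k-\log\bar r_0+\varepsilon_0$, so that $p_k^*(x;\lambda^\circ)=\bar r_kf_k(x)/\sum_l\bar r_lf_l(x)$. $D_\lambda$ denotes the gradient in $\lambda$, $\mathbf J^{(n)}(\lambda)=-D^2_{\lambda\lambda}\ell^{(n)}(\lambda)$; $E$, $\mathrm{Cov}$, $P$ refer to the true distribution. Define $\bar{\mathbf I}(\lambda)=\sum_k\bar r_kE[-D^2_{\lambda\lambda}\log p_k^*(X_k;\lambda)]$, $\bar{\boldsymbol\Sigma}(\lambda)=\sum_k\bar r_k\mathrm{Cov}(D_\lambda\log p_k^*(X_k;\lambda))$, $\mathbf I(\lambda)=n\bar{\mathbf I}(\lambda)=E\mathbf J^{(n)}(\lambda)$, $\boldsymbol\Sigma(\lambda)=n\bar{\boldsymbol\Sigma}(\lambda)=\mathrm{Cov}(D_\lambda\ell^{(n)}(\lambda))$. *)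

theory Defs
  imports "HOL-Analysis.Analysis" "HOL-Probability.Probability"
begin

definition grad :: "(real^'p \<Rightarrow> real) \<Rightarrow> real^'p \<Rightarrow> real^'p" where
  "grad f v = (\<chi> i. frechet_derivative f (at v) (axis i 1))"

definition hess :: "(real^'p \<Rightarrow> real) \<Rightarrow> real^'p \<Rightarrow> real^'p^'p" where
  "hess f v = (\<chi> i j. frechet_derivative (\<lambda>w. grad f w $ j) (at v) (axis i 1))"

fun Ck :: "nat \<Rightarrow> (real^'p \<Rightarrow> real) \<Rightarrow> bool" where
  "Ck 0 f = continuous_on UNIV f"
| "Ck (Suc k) f = ((\<forall>v. f differentiable (at v)) \<and>
      (\<forall>i. Ck k (\<lambda>v. frechet_derivative f (at v) (axis i 1))))"

definition pos_def :: "real^'p^'p \<Rightarrow> bool" where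
  "pos_def A \<longleftrightarrow> transpose A = A \<and> (\<forall>v. v \<noteq> 0 \<longrightarrow> v \<bullet> (A *v v) > 0)"

definition conv_prob :: "'a measure \<Rightarrow> (nat \<Rightarrow> 'a \<Rightarrow> 'b::euclidean_space) \<Rightarrow> 'b \<Rightarrow> bool" where
  "conv_prob M Z c \<longleftrightarrow> (\<forall>n. Z n \<in> borel_measurable M) \<and>
     (\<forall>e>0. (\<lambda>n. measure M {\<omega>\<in>space M. dist (Z n \<omega>) c > e}) \<longlonglongrightarrow> 0)"

definition conv_distr :: "'a measure \<Rightarrow> (nat \<Rightarrow> 'a \<Rightarrow> 'b::euclidean_space) \<Rightarrow> 'b measure \<Rightarrow> bool" where
  "conv_distr M Z \<mu> \<longleftrightarrow> (\<forall>n. Z n \<in> borel_measurable M) \<and>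
     (\<forall>g::'b \<Rightarrow> real. continuous_on UNIV g \<and> bounded (range g) \<longrightarrow>
        (\<lambda>n. integral\<^sup>L M (\<lambda>\<omega>. g (Z n \<omega>))) \<longlonglongrightarrow> integral\<^sup>L \<mu> g)"

definition mv_normal :: "(real^'p) measure \<Rightarrow> real^'p \<Rightarrow> real^'p^'p \<Rightarrow> bool" where
  "mv_normal \<mu> m V \<longleftrightarrow> prob_space \<mu> \<and> sets \<mu> = sets borel \<and>
     (\<forall>t. integral\<^sup>L \<mu> (\<lambda>x. cis (t \<bullet> x)) =
           cis (t \<bullet> m) * complex_of_real (exp (- (t \<bullet> (V *v t)) / 2)))"

definition covmat :: "'x measure \<Rightarrow> ('x \<Rightarrow> real^'p) \<Rightarrow> real^'p^'p" where
  "covmat P V = (\<chi> i j. integral\<^sup>L P (\<lambda>x. (V x $ i - integral\<^sup>L P (\<lambda>z. V z $ i)) *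
                                         (V x $ j - integral\<^sup>L P (\<lambda>z. V z $ j))))"

text \<open>Classes k = 0..K are indexed by 'k option: None is class 0, Some j is class j,
  so K = CARD('k).  The parameter \<lambda> = (\<theta>, \<gamma>*) lives in real^('s + 'k):
  components Inl i (i :: 's, S = CARD('s)) form \<theta>, components Inr j form \<gamma>*_j.\<close>

definition theta_of :: "real^('s::finite + 'k::finite) \<Rightarrow> real^'s" where
  "theta_of lam = (\<chi> i. lam $ Inl i)"

definition gam :: "real^('s::finite + 'k::finite) \<Rightarrow> 'k option \<Rightarrow> real" where
  "gam lam c = (case c of None \<Rightarrow> 0 | Some j \<Rightarrow> lam $ Inr j)"

definition mk_lam :: "real^'s \<Rightarrow> ('k \<Rightarrow> real) \<Rightarrow> real^('s::finite + 'k::finite)" where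
  "mk_lam th g = (\<chi> p. case p of Inl i \<Rightarrow> th $ i | Inr j \<Rightarrow> g j)"

definition p_star :: "(real^'s \<Rightarrow> 'x \<Rightarrow> 'y \<Rightarrow> real) \<Rightarrow> ('k option \<Rightarrow> 'y)
    \<Rightarrow> 'k option \<Rightarrow> 'x \<Rightarrow> real^('s::finite + 'k::finite) \<Rightarrow> real" where
  "p_star psi y c x lam =
     exp (gam lam c + psi (theta_of lam) x (y c)) /
     (\<Sum>l\<in>UNIV. exp (gam lam l + psi (theta_of lam) x (y l)))"

definition ssize :: "('k option \<Rightarrow> real) \<Rightarrow> nat \<Rightarrow> 'k option \<Rightarrow> nat" where
  "ssize r n c = nat \<lfloor>r c * real n\<rfloor>"

definition loglik :: "(real^'s \<Rightarrow> 'x \<Rightarrow> 'y \<Rightarrow> real) \<Rightarrow> ('k option \<Rightarrow> 'y)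
    \<Rightarrow> ('k option \<Rightarrow> real) \<Rightarrow> ('k option \<Rightarrow> nat \<Rightarrow> 'a \<Rightarrow> 'x) \<Rightarrow> nat \<Rightarrow> 'a
    \<Rightarrow> real^('s::finite + 'k::finite) \<Rightarrow> real" where
  "loglik psi y r X n \<omega> lam =
     (\<Sum>c\<in>UNIV. \<Sum>i<ssize r n c. ln (p_star psi y c (X c i \<omega>) lam))"

definition Ibar :: "(real^'s \<Rightarrow> 'x \<Rightarrow> 'y \<Rightarrow> real) \<Rightarrow> ('k option \<Rightarrow> 'y)
    \<Rightarrow> ('k option \<Rightarrow> real) \<Rightarrow> ('k option \<Rightarrow> 'x measure)
    \<Rightarrow> real^('s::finite + 'k::finite) \<Rightarrow> real^('s + 'k)^('s + 'k)" where
  "Ibar psi y r P lam =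
     (\<Sum>c\<in>UNIV. r c *\<^sub>R integral\<^sup>L (P c) (\<lambda>x. - hess (\<lambda>l. ln (p_star psi y c x l)) lam))"

definition Sigmabar :: "(real^'s \<Rightarrow> 'x \<Rightarrow> 'y \<Rightarrow> real) \<Rightarrow> ('k option \<Rightarrow> 'y)
    \<Rightarrow> ('k option \<Rightarrow> real) \<Rightarrow> ('k option \<Rightarrow> 'x measure)
    \<Rightarrow> real^('s::finite + 'k::finite) \<Rightarrow> real^('s + 'k)^('s + 'k)" where
  "Sigmabar psi y r P lam =
     (\<Sum>c\<in>UNIV. r c *\<^sub>R covmat (P c) (\<lambda>x. grad (\<lambda>l. ln (p_star psi y c x l)) lam))"

end

theory Submission
  imports Defs
begin

text \<open>
  Convergence in distribution on a Euclidean space is reduced to pointwise convergence of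
  characteristic functions: the one-dimensional continuity theorem, applied to the coordinates, gives
  tightness, and on a large cube a bounded continuous function is uniformly close to a trigonometric
  polynomial that stays bounded on the whole space.  With this, the normalized score at the true
  parameter is asymptotically normal by the one-dimensional central limit theorem in each class and
  independence across classes.

  Expanding the estimating equation with an integral remainder gives
  \<open>U - B W = e\<close>, where \<open>U\<close> is the normalized score, \<open>W\<close> the rescaled estimation error,
  \<open>B \<rightarrow> I\<close> and \<open>e \<rightarrow> 0\<close> in probability.  Invertibility of \<open>I\<close> yields \<open>W - I\<^sup>-\<^sup>1 U \<rightarrow> 0\<close>.

  For the \<open>\<theta>\<close>-block, twofold differentiation of \<open>\<Sum>\<^sub>c p\<^sub>c = 1\<close> gives
  \<open>\<Sigma> = I - \<Sum>\<^sub>c r\<^sub>c m\<^sub>c m\<^sub>c\<^sup>T\<close> with the mean scores \<open>m\<^sub>c\<close>, and the column of \<open>I\<close> belonging to \<open>\<gamma>\<^sub>j\<close> is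
  \<open>r\<^sub>j m\<^sub>j\<close>.  As \<open>\<Sum>\<^sub>c r\<^sub>c m\<^sub>c = 0\<close>, every \<open>I\<^sup>-\<^sup>1 m\<^sub>c\<close> has vanishing \<open>\<theta>\<close>-components.
\<close>

section \<open>Weak convergence on Euclidean spaces\<close>

text \<open>Class sizes are fixed by design, so the score at the true parameter is centred only
  after weighting the classes by \<open>r\<close>; inside one class its mean m_c need not vanish.
  The limit theorem is therefore applied to scores centred class by class, and the subtracted means
  cancel because every class size is exactly \<open>r c * n\<close>. The same means separate
  \<Sigma> from I: the information is a weighted second moment of the scores, \<Sigma> a weighted
  sum of within-class covariances. This is why the sandwich in (a) does not in general reduce to the
  inverse of I.

  \<Sigma> may be singular even when I is positive definite: if \<open>psi\<close> vanishes at
  \<open>theta0\<close>, all densities \<open>f c\<close> agree and the \<gamma>-scores are constant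
  within every class. Hence a normal law is encoded by its characteristic function, its existence is
  proved for positive semidefinite matrices, and the one-dimensional limit theorem has to cover
  variance zero.\<close>

inductive trig_poly :: "('b::real_inner \<Rightarrow> real) \<Rightarrow> bool" where
  cos: "trig_poly (\<lambda>x. c * cos (t \<bullet> x + b))"
| add: "trig_poly f \<Longrightarrow> trig_poly g \<Longrightarrow> trig_poly (\<lambda>x. f x + g x)"

lemma trig_poly_const: "trig_poly (\<lambda>x. c)"
  using trig_poly.cos[of c 0 0] by simp

lemma trig_poly_sin: "trig_poly (\<lambda>x. c * sin (t \<bullet> x))"
proof -
  have "sin (t \<bullet> x) = cos (t \<bullet> x + (- pi / 2))" for x
    unfolding cos_add by simp
  then show ?thesis using trig_poly.cos[of c t "- pi / 2"] by (simp only:)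
qed

lemma trig_poly_sum:
  "finite A \<Longrightarrow> (\<And>i. i \<in> A \<Longrightarrow> trig_poly (f i)) \<Longrightarrow> trig_poly (\<lambda>x. \<Sum>i\<in>A. f i x)"
  by (induction A rule: finite_induct) (auto intro: trig_poly_const trig_poly.add)

text \<open>Product-to-sum formula. Allowing a phase in the generators keeps both resulting terms in
  the same shape; the phase also makes constants (frequency 0) and sines (phase -pi/2) special
  cases.\<close>

lemma trig_poly_cos_mult:
  assumes "trig_poly g"
  shows "trig_poly (\<lambda>x. c * cos (t \<bullet> x + b) * g x)"
  using assms
proof (induction rule: trig_poly.induct)
  case (cos c' t' b')
  have "c * cos (t \<bullet> x + b) * (c' * cos (t' \<bullet> x + b')) =
      (c * c' / 2) * cos ((t - t') \<bullet> x + (b - b')) + (c * c' / 2) * cos ((t + t') \<bullet> x + (b + b'))" for x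
  proof -
    have 1: "(t - t') \<bullet> x + (b - b') = (t \<bullet> x + b) - (t' \<bullet> x + b')"
      "(t + t') \<bullet> x + (b + b') = (t \<bullet> x + b) + (t' \<bullet> x + b')"
      by (simp_all add: inner_diff_left inner_add_left)
    show ?thesis unfolding 1 cos_add cos_diff by (simp add: algebra_simps)
  qed
  then show ?case by (simp only: trig_poly.intros)
next
  case (add f g)
  then show ?case by (auto simp: distrib_left intro: trig_poly.add)
qed

lemma trig_poly_mult:
  assumes "trig_poly f" "trig_poly g"
  shows "trig_poly (\<lambda>x. f x * g x)"
  using assms(1)
  by (induction rule: trig_poly.induct)
    (auto simp: distrib_right intro: trig_poly.add trig_poly_cos_mult[OF assms(2)])

text \<open>Polynomial functions arise from linear functionals by sums and products, and a linear
  functional of the vector of sines is a combination of the single sines.\<close>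

lemma trig_poly_real_polynomial_sin:
  fixes q :: "'b::euclidean_space \<Rightarrow> real"
  assumes "real_polynomial_function q"
  shows "trig_poly (\<lambda>x. q (\<Sum>i\<in>Basis. sin (a * (x \<bullet> i)) *\<^sub>R i))"
  using assms
proof (induction rule: real_polynomial_function.induct)
  case (linear f)
  have "f (\<Sum>i\<in>Basis. sin (a * (x \<bullet> i)) *\<^sub>R i) = (\<Sum>i\<in>Basis. f i * sin ((a *\<^sub>R i) \<bullet> x))" for x
    using linear
    by (simp add: linear_sum bounded_linear.linear linear_cmul inner_commute mult.commute)
  then show ?case by (simp only: trig_poly_sum trig_poly_sin finite_Basis)
qed (auto intro: trig_poly_const trig_poly.add trig_poly_mult)

lemma trig_poly_measurable:
  fixes f :: "'b::euclidean_space \<Rightarrow> real"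
  assumes "trig_poly f" shows "f \<in> borel_measurable borel"
  using assms by induction auto

lemma trig_poly_bounded: "trig_poly f \<Longrightarrow> \<exists>B. \<forall>x. \<bar>f x\<bar> \<le> B"
proof (induction rule: trig_poly.induct)
  case (cos c t b)
  have "\<bar>c * cos (t \<bullet> x + b)\<bar> \<le> \<bar>c\<bar>" for x
    by (simp add: abs_mult mult_left_le)
  then show ?case by blast
next
  case (add f g)
  then obtain B C where "\<bar>f x\<bar> \<le> B" "\<bar>g x\<bar> \<le> C" for x by blast
  then have "\<bar>f x + g x\<bar> \<le> B + C" for x
    by (rule order_trans[OF abs_triangle_ineq add_mono])
  then show ?case by blast
qed

text \<open>
  On the cube \<open>\<bar>x \<bullet> i\<bar> \<le> R\<close> the point \<open>x\<close> is recovered as the arcsine of \<open>sin (a x)\<close> for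
  \<open>a = pi / (2 R)\<close>.  A polynomial approximation in these sines is
  therefore uniformly good on the cube and at the same time bounded on the whole space.
\<close>

lemma trig_poly_approx:
  fixes g :: "'b::euclidean_space \<Rightarrow> real"
  assumes g: "continuous_on UNIV g" and B: "\<And>x. \<bar>g x\<bar> \<le> B" and "R > 0" "e > 0"
  obtains Q where "trig_poly Q" "\<And>x. (\<forall>i\<in>Basis. \<bar>x \<bullet> i\<bar> \<le> R) \<Longrightarrow> \<bar>g x - Q x\<bar> < e"
    "\<And>x. \<bar>Q x\<bar> \<le> B + e"
proof -
  define a where "a = pi / (2 * R)"
  have a: "a > 0" using \<open>R > 0\<close> by (simp add: a_def)
  define h where "h s = g (\<Sum>i\<in>Basis. (arcsin (s \<bullet> i) / a) *\<^sub>R i)" for s :: 'b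
  have h: "continuous_on (cbox (- One) One) h"
    unfolding h_def
    by (intro continuous_on_compose2[OF g] continuous_intros) (auto simp: mem_box a[THEN less_imp_neq, symmetric])
  obtain q where q: "real_polynomial_function q"
    "\<And>s. s \<in> cbox (- One) One \<Longrightarrow> \<bar>h s - q s\<bar> < e"
    by (rule Stone_Weierstrass_real_polynomial_function[OF compact_cbox h \<open>e > 0\<close>]) (rule that)
  define s where "s x = (\<Sum>i\<in>Basis. sin (a * (x \<bullet> i)) *\<^sub>R i)" for x :: 'b
  have s_in: "s x \<in> cbox (- One) One" for x
    by (auto simp: s_def mem_box)
  show ?thesis
  proof (rule that[of "\<lambda>x. q (s x)"])
    show "trig_poly (\<lambda>x. q (s x))"
      unfolding s_def by (rule trig_poly_real_polynomial_sin[OF q(1)])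
    show "\<bar>q (s x)\<bar> \<le> B + e" for x
    proof -
      \<comment> \<open>For \<open>x\<close> outside the cube, \<open>h (s x)\<close> is still a
        value of \<open>g\<close>, only at another point; so \<open>B\<close> bounds it for every
        \<open>x\<close>.\<close>
      have "\<bar>h (s x)\<bar> \<le> B" unfolding h_def by (rule B)
      then show ?thesis using q(2)[OF s_in[of x]] by linarith
    qed
    show "\<bar>g x - q (s x)\<bar> < e" if x: "\<forall>i\<in>Basis. \<bar>x \<bullet> i\<bar> \<le> R" for x
    proof -
      have "arcsin (s x \<bullet> i) / a = x \<bullet> i" if "i \<in> Basis" for i
      proof -
        have "\<bar>a * (x \<bullet> i)\<bar> \<le> a * R"
          using x that a by (simp add: abs_mult)
        also have "a * R = pi / 2" using \<open>R > 0\<close> by (simp add: a_def)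
        finally have "arcsin (sin (a * (x \<bullet> i))) = a * (x \<bullet> i)"
          by (intro arcsin_sin) auto
        then show ?thesis using that a by (simp add: s_def)
      qed
      then have "h (s x) = g x"
        unfolding h_def by (simp add: euclidean_representation)
      then show ?thesis using q(2)[OF s_in[of x]] by simp
    qed
  qed
qed

lemma bounded_range_real: "bounded (range g) \<Longrightarrow> \<exists>B. \<forall>x. \<bar>g x :: real\<bar> \<le> B"
  unfolding bounded_iff by auto

lemma norm_le_DIM_mult:
  fixes x :: "'b::euclidean_space"
  assumes "\<And>i. i \<in> Basis \<Longrightarrow> \<bar>x \<bullet> i\<bar> \<le> R"
  shows "norm x \<le> real DIM('b) * R"
  by (rule order_trans[OF norm_le_l1 sum_bounded_above[where K=R and f = "\<lambda>i. \<bar>x \<bullet> i\<bar>"]]) (rule assms)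

section \<open>Tightness\<close>

lemma (in prob_space) prob_norm_tail:
  fixes Z :: "'a \<Rightarrow> 'b::euclidean_space"
  assumes [measurable]: "Z \<in> borel_measurable M" and "e > 0"
  obtains R where "R > 0" "prob {\<omega>\<in>space M. norm (Z \<omega>) > R} < e"
proof -
  define A where "A n = {\<omega>\<in>space M. norm (Z \<omega>) > real n}" for n :: nat
  have "(\<lambda>n. prob (A n)) \<longlonglongrightarrow> prob (\<Inter>n. A n)"
  proof (rule finite_Lim_measure_decseq)
    show "range A \<subseteq> events" unfolding A_def by auto
    show "decseq A" unfolding A_def decseq_def
      by (auto intro: le_less_trans)
  qed
  also have "(\<Inter>n. A n) = {}"
  proof -
    have "\<omega> \<notin> (\<Inter>n. A n)" for \<omega>
    proof -
      obtain n where "norm (Z \<omega>) \<le> real n" using real_arch_simple by blast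
      then have "\<omega> \<notin> A n" by (simp add: A_def)
      then show ?thesis by blast
    qed
    then show ?thesis by blast
  qed
  finally have "(\<lambda>n. prob (A n)) \<longlonglongrightarrow> 0" by simp
  then have "\<forall>\<^sub>F n in sequentially. prob (A n) < e"
    using \<open>e > 0\<close> by (rule order_tendstoD)
  \<comment> \<open>Passing to \<open>Suc n\<close> keeps the radius strictly positive.\<close>
  then obtain n where "prob (A (Suc n)) < e"
    unfolding eventually_sequentially using le_SucI by blast
  then show ?thesis using that[of "real (Suc n)"] by (simp add: A_def)
qed

definition tight_seq :: "'a measure \<Rightarrow> (nat \<Rightarrow> 'a \<Rightarrow> 'b::euclidean_space) \<Rightarrow> bool" where
  "tight_seq M Z \<longleftrightarrow> (\<forall>e>0. \<exists>R>0. \<forall>\<^sub>F n in sequentially.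
     measure M {\<omega>\<in>space M. norm (Z n \<omega>) > R} < e)"

lemma conv_distr_bounded_continuous:
  assumes "conv_distr M Z \<mu>" "continuous_on UNIV g" "\<And>x. \<bar>g x\<bar> \<le> (B::real)"
  shows "(\<lambda>n. \<integral>\<omega>. g (Z n \<omega>) \<partial>M) \<longlonglongrightarrow> (\<integral>x. g x \<partial>\<mu>)"
  using assms unfolding conv_distr_def
  by (metis (mono_tags, lifting) bounded_iff image_iff real_norm_def)

text \<open>Indicators of tail events are not continuous, so a ramp is placed between two of them:
  it is 0 up to radius R and 1 beyond R + 1. Thus the tail of the limit beyond R controls the tails
  of \<open>Z n\<close> beyond R + 1.\<close>

lemma conv_distr_imp_tight:
  fixes Z :: "nat \<Rightarrow> 'a \<Rightarrow> 'b::euclidean_space"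
  assumes "prob_space M" "prob_space \<mu>" and sets: "sets \<mu> = sets borel"
    and Z: "conv_distr M Z \<mu>"
  shows "tight_seq M Z"
  unfolding tight_seq_def
proof safe
  interpret M: prob_space M by fact
  interpret \<mu>: prob_space \<mu> by fact
  fix e :: real assume "e > 0"
  have sp: "space \<mu> = UNIV" using sets_eq_imp_space_eq[OF sets] by simp
  have [measurable_cong]: "sets \<mu> = sets borel" by fact
  have [measurable]: "Z n \<in> borel_measurable M" for n using Z by (simp add: conv_distr_def)
  obtain R where R: "R > 0" "\<mu>.prob {x \<in> space \<mu>. norm x > R} < e"
    using \<mu>.prob_norm_tail[of "\<lambda>x. x"] \<open>e > 0\<close> by auto
  define g :: "'b \<Rightarrow> real" where "g x = min 1 (max 0 (norm x - R))" for x
  have g1: "\<bar>g x\<bar> \<le> 1" and gc: "continuous_on UNIV g" for x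
    unfolding g_def by (auto intro!: continuous_intros)
  have [measurable]: "g \<in> borel_measurable borel"
    using gc by (rule borel_measurable_continuous_onI)
  have "(\<integral>x. g x \<partial>\<mu>) \<le> (\<integral>x. indicator {x \<in> space \<mu>. norm x > R} x \<partial>\<mu>)"
    by (intro integral_mono \<mu>.integrable_const_bound[where B=1] \<mu>.integrable_const_bound[where B=1 and f = "indicator _"])
       (auto simp: g1 g_def sp split: split_indicator)
  also have "\<dots> < e" using R by (simp add: sp)
  finally have "\<forall>\<^sub>F n in sequentially. (\<integral>\<omega>. g (Z n \<omega>) \<partial>M) < e"
    by (intro order_tendstoD(2)[OF conv_distr_bounded_continuous[OF Z gc g1]])
  moreover have "M.prob {\<omega> \<in> space M. norm (Z n \<omega>) > R + 1} \<le> (\<integral>\<omega>. g (Z n \<omega>) \<partial>M)" for n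
  proof -
    have "M.prob {\<omega> \<in> space M. norm (Z n \<omega>) > R + 1} =
        (\<integral>\<omega>. indicator {\<omega> \<in> space M. norm (Z n \<omega>) > R + 1} \<omega> \<partial>M)"
      by simp
    also have "\<dots> \<le> (\<integral>\<omega>. g (Z n \<omega>) \<partial>M)"
      by (intro integral_mono M.integrable_const_bound[where B=1] M.integrable_const_bound[where B=1 and f = "indicator _"])
         (auto simp: g1 g_def split: split_indicator)
    finally show ?thesis .
  qed
  ultimately show "\<exists>R>0. \<forall>\<^sub>F n in sequentially. M.prob {\<omega> \<in> space M. norm (Z n \<omega>) > R} < e"
    using R(1) by (intro exI[of _ "R + 1"]) (auto elim!: eventually_mono intro: le_less_trans)
qed

lemma tight_seq_componentwise:
  fixes Z :: "nat \<Rightarrow> 'a \<Rightarrow> 'b::euclidean_space"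
  assumes "prob_space M" and [measurable]: "\<And>n. Z n \<in> borel_measurable M"
    and tight: "\<And>i. i \<in> Basis \<Longrightarrow> tight_seq M (\<lambda>n \<omega>. Z n \<omega> \<bullet> i)"
  shows "tight_seq M Z"
  unfolding tight_seq_def
proof safe
  interpret prob_space M by fact
  fix e :: real assume "e > 0"
  define d where "d = e / real DIM('b)"
  have "d > 0" using \<open>e > 0\<close> by (simp add: d_def)
  then have "\<forall>i\<in>Basis. \<exists>R>0. \<forall>\<^sub>F n in sequentially. prob {\<omega>\<in>space M. \<bar>Z n \<omega> \<bullet> i\<bar> > R} < d"
    using tight unfolding tight_seq_def real_norm_def by blast
  from bchoice[OF this] obtain R where R: "\<And>i. i \<in> Basis \<Longrightarrow> R i > 0"
    "\<And>i. i \<in> Basis \<Longrightarrow> \<forall>\<^sub>F n in sequentially. prob {\<omega>\<in>space M. \<bar>Z n \<omega> \<bullet> i\<bar> > R i} < d"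
    by auto
  \<comment> \<open>The sum serves as a common upper bound of the coordinate radii. A norm above
    \<open>DIM('b) * S\<close> forces some coordinate beyond \<open>S\<close>, and the union bound
    over the coordinates explains the share \<open>e / DIM('b)\<close>.\<close>
  define S where "S = (\<Sum>i\<in>(Basis :: 'b set). R i)"
  have RS: "R i \<le> S" if "i \<in> Basis" for i
    unfolding S_def using that R(1) by (intro member_le_sum) (auto intro: less_imp_le)
  have "S > 0" using less_le_trans[OF R(1)[OF SOME_Basis] RS[OF SOME_Basis]] .
  have "\<forall>\<^sub>F n in sequentially. \<forall>i\<in>Basis. prob {\<omega>\<in>space M. \<bar>Z n \<omega> \<bullet> i\<bar> > R i} < d"
    using R(2) by (intro eventually_ball_finite) auto
  then have "\<forall>\<^sub>F n in sequentially. prob {\<omega>\<in>space M. norm (Z n \<omega>) > real DIM('b) * S} < e"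
  proof (rule eventually_mono)
    fix n assume n: "\<forall>i\<in>Basis. prob {\<omega>\<in>space M. \<bar>Z n \<omega> \<bullet> i\<bar> > R i} < d"
    have "prob {\<omega>\<in>space M. norm (Z n \<omega>) > real DIM('b) * S}
        \<le> prob (\<Union>i\<in>Basis. {\<omega>\<in>space M. \<bar>Z n \<omega> \<bullet> i\<bar> > R i})"
    proof (intro finite_measure_mono)
      show "{\<omega> \<in> space M. real DIM('b) * S < norm (Z n \<omega>)}
          \<subseteq> (\<Union>i\<in>Basis. {\<omega> \<in> space M. R i < \<bar>Z n \<omega> \<bullet> i\<bar>})"
      proof safe
        fix \<omega> assume "\<omega> \<in> space M" "real DIM('b) * S < norm (Z n \<omega>)"
        then obtain i where "i \<in> Basis" "\<bar>Z n \<omega> \<bullet> i\<bar> > S"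
          using norm_le_DIM_mult[of "Z n \<omega>" S] by (meson not_less)
        then show "\<omega> \<in> (\<Union>i\<in>Basis. {\<omega> \<in> space M. R i < \<bar>Z n \<omega> \<bullet> i\<bar>})"
          using RS[of i] \<open>\<omega> \<in> space M\<close> by force
      qed
    qed auto
    also have "\<dots> \<le> (\<Sum>i\<in>Basis. prob {\<omega>\<in>space M. \<bar>Z n \<omega> \<bullet> i\<bar> > R i})"
      by (intro finite_measure_subadditive_finite) auto
    also have "\<dots> < (\<Sum>i\<in>(Basis::'b set). d)"
      using n by (intro sum_strict_mono) auto
    also have "\<dots> = e" by (simp add: d_def)
    finally show "prob {\<omega>\<in>space M. norm (Z n \<omega>) > real DIM('b) * S} < e" .
  qed
  then show "\<exists>R>0. \<forall>\<^sub>F n in sequentially. prob {\<omega>\<in>space M. norm (Z n \<omega>) > R} < e"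
    using \<open>S > 0\<close> by (intro exI[of _ "real DIM('b) * S"]) auto
qed

section \<open>From characteristic functions to weak convergence\<close>

lemma trig_poly_integral_tendsto:
  fixes Z :: "nat \<Rightarrow> 'a \<Rightarrow> 'b::euclidean_space"
  assumes "prob_space M" "prob_space \<mu>" and sets: "sets \<mu> = sets borel"
    and [measurable]: "\<And>n. Z n \<in> borel_measurable M"
    and char: "\<And>t. (\<lambda>n. \<integral>\<omega>. cis (t \<bullet> Z n \<omega>) \<partial>M) \<longlonglongrightarrow> (\<integral>x. cis (t \<bullet> x) \<partial>\<mu>)"
    and Q: "trig_poly Q"
  shows "(\<lambda>n. \<integral>\<omega>. Q (Z n \<omega>) \<partial>M) \<longlonglongrightarrow> (\<integral>x. Q x \<partial>\<mu>)"
  using Q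
proof induction
  interpret M: prob_space M by fact
  interpret \<mu>: prob_space \<mu> by fact
  have [measurable_cong]: "sets \<mu> = sets borel" by fact
  have cis_meas [measurable]: "cis \<in> borel_measurable borel"
    by (intro borel_measurable_continuous_onI continuous_intros)
  case (cos c t b)
  have M_int: "integrable M (\<lambda>\<omega>. cis (t \<bullet> Z n \<omega>))" for n
    by (rule M.integrable_const_bound[where B=1]) auto
  have \<mu>_int: "integrable \<mu> (\<lambda>x. cis (t \<bullet> x))"
    by (rule \<mu>.integrable_const_bound[where B=1]) auto
  \<comment> \<open>A generator is the real part of a fixed complex multiple of
    \<open>cis (t \<bullet> x)\<close>, hence a continuous function of the characteristic function
    at \<open>t\<close> after integration.\<close>
  have rw: "c * cos (u + b) = c * Re (cis b * cis u)" for u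
    by (simp add: cos_add)
  have "(\<lambda>n. c * Re (cis b * (\<integral>\<omega>. cis (t \<bullet> Z n \<omega>) \<partial>M))) \<longlonglongrightarrow> c * Re (cis b * (\<integral>x. cis (t \<bullet> x) \<partial>\<mu>))"
    by (intro tendsto_intros char)
  moreover have "(\<integral>\<omega>. c * cos (t \<bullet> Z n \<omega> + b) \<partial>M) = c * Re (cis b * (\<integral>\<omega>. cis (t \<bullet> Z n \<omega>) \<partial>M))" for n
    using M_int unfolding rw
    by (subst integral_mult_right_zero[symmetric], subst integral_Re[symmetric]) auto
  moreover have "(\<integral>x. c * cos (t \<bullet> x + b) \<partial>\<mu>) = c * Re (cis b * (\<integral>x. cis (t \<bullet> x) \<partial>\<mu>))"
    using \<mu>_int unfolding rw
    by (subst integral_mult_right_zero[symmetric], subst integral_Re[symmetric]) auto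
  ultimately show ?case by (simp only:)
next
  interpret M: prob_space M by fact
  interpret \<mu>: prob_space \<mu> by fact
  have [measurable_cong]: "sets \<mu> = sets borel" by fact
  case (add f g)
  obtain B C where BC: "\<And>x. \<bar>f x\<bar> \<le> B" "\<And>x. \<bar>g x\<bar> \<le> C"
    using trig_poly_bounded add.hyps by metis
  note [measurable] = trig_poly_measurable[OF add.hyps(1)] trig_poly_measurable[OF add.hyps(2)]
  have "integrable M (\<lambda>\<omega>. f (Z n \<omega>))" "integrable M (\<lambda>\<omega>. g (Z n \<omega>))" for n
    using BC by (auto intro: M.integrable_const_bound[where B=B] M.integrable_const_bound[where B=C])
  moreover have "integrable \<mu> f" "integrable \<mu> g"
    using BC by (auto intro: \<mu>.integrable_const_bound[where B=B] \<mu>.integrable_const_bound[where B=C])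
  ultimately show ?case using add.IH by (auto intro: tendsto_add)
qed

text \<open>Stated for a random vector \<open>W\<close> so that it serves twice: with
  \<open>Z n\<close> under \<open>M\<close>, and with the identity under the limit law.\<close>

lemma (in prob_space) integral_diff_le_tail:
  fixes g h :: "'b::euclidean_space \<Rightarrow> real"
  assumes W [measurable]: "W \<in> borel_measurable M"
    and [measurable]: "g \<in> borel_measurable borel" "h \<in> borel_measurable borel"
    and B: "\<And>x. \<bar>g x\<bar> \<le> B" "\<And>x. \<bar>h x\<bar> \<le> B"
    and close: "\<And>x. norm x \<le> R \<Longrightarrow> \<bar>g x - h x\<bar> \<le> d" and "0 \<le> d"
  shows "\<bar>(\<integral>\<omega>. g (W \<omega>) \<partial>M) - (\<integral>\<omega>. h (W \<omega>) \<partial>M)\<bar>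
    \<le> d + 2 * B * prob {\<omega>\<in>space M. norm (W \<omega>) > R}"
proof -
  let ?I = "\<lambda>\<omega>. indicator {\<omega>\<in>space M. norm (W \<omega>) > R} \<omega> :: real"
  have int: "integrable M (\<lambda>\<omega>. g (W \<omega>))" "integrable M (\<lambda>\<omega>. h (W \<omega>))"
    using B by (auto intro!: integrable_const_bound[where B=B])
  have Iint: "integrable M ?I" by (rule integrable_const_bound[where B=1]) auto
  have bound: "\<bar>g (W \<omega>) - h (W \<omega>)\<bar> \<le> d + 2 * B * ?I \<omega>" if "\<omega> \<in> space M" for \<omega>
  proof (cases "norm (W \<omega>) > R")
    case True
    then show ?thesis using B(1)[of "W \<omega>"] B(2)[of "W \<omega>"] that \<open>0 \<le> d\<close> by simp
  next
    case False
    then show ?thesis using close[of "W \<omega>"] by simp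
  qed
  have "(\<integral>\<omega>. g (W \<omega>) \<partial>M) - (\<integral>\<omega>. h (W \<omega>) \<partial>M) = (\<integral>\<omega>. g (W \<omega>) - h (W \<omega>) \<partial>M)"
    using int by simp
  also have "\<bar>\<dots>\<bar> \<le> (\<integral>\<omega>. \<bar>g (W \<omega>) - h (W \<omega>)\<bar> \<partial>M)"
    by (rule integral_abs_bound)
  also have "\<dots> \<le> (\<integral>\<omega>. d + 2 * B * ?I \<omega> \<partial>M)"
    using bound by (intro integral_mono integrable_abs Bochner_Integration.integrable_diff int
        Bochner_Integration.integrable_add integrable_mult_right Iint) auto
  also have "\<dots> = d + 2 * B * prob {\<omega>\<in>space M. norm (W \<omega>) > R}"
    using Iint by (subst Bochner_Integration.integral_add) (auto simp: prob_space)
  finally show ?thesis .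
qed

theorem levy_continuity_euclidean:
  fixes Z :: "nat \<Rightarrow> 'a \<Rightarrow> 'b::euclidean_space"
  assumes "prob_space M" "prob_space \<mu>" and sets: "sets \<mu> = sets borel"
    and Z [measurable]: "\<And>n. Z n \<in> borel_measurable M"
    and char: "\<And>t. (\<lambda>n. \<integral>\<omega>. cis (t \<bullet> Z n \<omega>) \<partial>M) \<longlonglongrightarrow> (\<integral>x. cis (t \<bullet> x) \<partial>\<mu>)"
  shows "conv_distr M Z \<mu>"
  unfolding conv_distr_def
proof (intro conjI allI impI)
  interpret M: prob_space M by fact
  interpret \<mu>: prob_space \<mu> by fact
  have [measurable_cong]: "sets \<mu> = sets borel" by fact
  show "Z n \<in> borel_measurable M" for n by fact
  have tight: "tight_seq M Z"
  proof (rule tight_seq_componentwise)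
    fix i :: 'b assume "i \<in> Basis"
    let ?M = "\<lambda>n. distr M borel (\<lambda>\<omega>. Z n \<omega> \<bullet> i)" and ?\<mu> = "distr \<mu> borel (\<lambda>x. x \<bullet> i)"
    have rd: "real_distribution (?M n)" "real_distribution ?\<mu>" for n
      by (auto intro!: M.real_distribution_distr \<mu>.real_distribution_distr)
    have "weak_conv_m ?M ?\<mu>"
    proof (rule levy_continuity[OF rd])
      fix t :: real
      show "(\<lambda>n. char (?M n) t) \<longlonglongrightarrow> char ?\<mu> t"
        using char[of "t *\<^sub>R i"]
        by (simp add: char_def integral_distr cis_conv_exp inner_commute)
    qed
    note conv = weak_conv_imp_integral_bdd_continuous_conv[OF rd this]
    have "conv_distr M (\<lambda>n \<omega>. Z n \<omega> \<bullet> i) ?\<mu>"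
      unfolding conv_distr_def
    proof (intro conjI allI impI)
      fix g :: "real \<Rightarrow> real" assume g: "continuous_on UNIV g \<and> bounded (range g)"
      have [measurable]: "g \<in> borel_measurable borel"
        using g by (auto intro: borel_measurable_continuous_onI)
      obtain B where "\<And>x. \<bar>g x\<bar> \<le> B" using g bounded_range_real by metis
      then have "(\<lambda>n. LINT x|?M n. g x) \<longlonglongrightarrow> (LINT x|?\<mu>. g x)"
        using g by (intro conv[where B=B]) (auto simp: continuous_on_eq_continuous_at)
      then show "(\<lambda>n. LINT \<omega>|M. g (Z n \<omega> \<bullet> i)) \<longlonglongrightarrow> (LINT x|?\<mu>. g x)"
        by (simp add: integral_distr)
    qed measurable
    then show "tight_seq M (\<lambda>n \<omega>. Z n \<omega> \<bullet> i)"
      using M.prob_space_axioms real_distribution.axioms(1)[OF rd(2)]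
      by (rule_tac conv_distr_imp_tight) auto
  qed (use M.prob_space_axioms in measurable)
  fix g :: "'b \<Rightarrow> real" assume g: "continuous_on UNIV g \<and> bounded (range g)"
  have [measurable]: "g \<in> borel_measurable borel"
    using g by (auto intro: borel_measurable_continuous_onI)
  obtain B where B: "\<And>x. \<bar>g x\<bar> \<le> B" using g bounded_range_real by metis
  have "B \<ge> 0" using B[of 0] by linarith
  show "(\<lambda>n. \<integral>\<omega>. g (Z n \<omega>) \<partial>M) \<longlonglongrightarrow> (\<integral>x. g x \<partial>\<mu>)"
  proof (rule tendstoI)
    fix e :: real assume "e > 0"
    \<comment> \<open>The bound \<open>d \<le> 1\<close> turns \<open>2 * (B + d)\<close> into at
      most \<open>2 * B + 2\<close>. The total error is one \<open>d\<close> for the trigonometric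
      polynomial and \<open>d + (2 * B + 2) * d\<close> for each of the two replacements of
      \<open>g\<close>, that is \<open>(4 * B + 7) * d\<close>, strictly below the denominator times
      \<open>d\<close>.\<close>
    define d where "d = min 1 (e / (2 * (2 * B + 2) + 4))"
    have D: "2 * (2 * B + 2) + 4 > 0" using \<open>B \<ge> 0\<close> by simp
    have d: "d > 0" "d \<le> 1"
      using \<open>e > 0\<close> D by (auto simp: d_def)
    have dD: "d * (2 * (2 * B + 2) + 4) \<le> e"
      unfolding pos_le_divide_eq[OF D, symmetric] by (simp add: d_def)
    obtain R1 where R1: "R1 > 0"
      "\<forall>\<^sub>F n in sequentially. M.prob {\<omega>\<in>space M. norm (Z n \<omega>) > R1} < d"
      using tight \<open>d > 0\<close> unfolding tight_seq_def by blast
    obtain R2 where R2: "R2 > 0" "\<mu>.prob {x\<in>space \<mu>. norm x > R2} < d"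
      using \<mu>.prob_norm_tail[of "\<lambda>x. x"] \<open>d > 0\<close> by auto
    define R where "R = max R1 R2"
    have "R > 0" using R1 by (simp add: R_def)
    have gc: "continuous_on UNIV g" using g by simp
    obtain Q where Q: "trig_poly Q" "\<And>x. (\<forall>i\<in>Basis. \<bar>x \<bullet> i\<bar> \<le> R) \<Longrightarrow> \<bar>g x - Q x\<bar> < d"
      "\<And>x. \<bar>Q x\<bar> \<le> B + d"
      by (rule trig_poly_approx[OF gc B \<open>R > 0\<close> \<open>d > 0\<close>]) (rule that)
    note [measurable] = trig_poly_measurable[OF Q(1)]
    have close: "\<bar>g x - Q x\<bar> \<le> d" if "norm x \<le> R" for x
    proof -
      have "\<bar>x \<bullet> i\<bar> \<le> R" if "i \<in> Basis" for i
        using Basis_le_norm[OF that, of x] \<open>norm x \<le> R\<close> by simp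
      then show ?thesis using Q(2)[of x] by force
    qed
    have Bd: "\<bar>g x\<bar> \<le> B + d" for x using B[of x] d by simp
    have tail: "d + (2 * (B + d)) * q \<le> d + (2 * B + 2) * d" if "q < d" "q \<ge> 0" for q
      using that d \<open>B \<ge> 0\<close> by (intro add_left_mono mult_mono) auto
    have "\<forall>\<^sub>F n in sequentially. dist (\<integral>\<omega>. Q (Z n \<omega>) \<partial>M) (\<integral>x. Q x \<partial>\<mu>) < d"
      by (rule tendstoD[OF trig_poly_integral_tendsto[OF assms(1,2) sets Z char Q(1)] \<open>d > 0\<close>])
    with R1(2) show "\<forall>\<^sub>F n in sequentially. dist (\<integral>\<omega>. g (Z n \<omega>) \<partial>M) (\<integral>x. g x \<partial>\<mu>) < e"
    proof eventually_elim
      case (elim n)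
      have "\<bar>(\<integral>\<omega>. g (Z n \<omega>) \<partial>M) - (\<integral>\<omega>. Q (Z n \<omega>) \<partial>M)\<bar> \<le> d + (2 * B + 2) * d"
      proof -
        have "M.prob {\<omega>\<in>space M. norm (Z n \<omega>) > R} \<le> M.prob {\<omega>\<in>space M. norm (Z n \<omega>) > R1}"
          by (intro M.finite_measure_mono) (auto simp: R_def)
        with elim(1) have "M.prob {\<omega>\<in>space M. norm (Z n \<omega>) > R} < d" by simp
        from tail[OF this] show ?thesis
          by (intro order_trans[OF M.integral_diff_le_tail[where B="B + d" and d=d and R=R]] Z Bd Q close)
             (use \<open>d > 0\<close> in auto)
      qed
      moreover have "\<bar>(\<integral>x. g x \<partial>\<mu>) - (\<integral>x. Q x \<partial>\<mu>)\<bar> \<le> d + (2 * B + 2) * d"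
      proof -
        have "\<mu>.prob {x\<in>space \<mu>. norm x > R} \<le> \<mu>.prob {x\<in>space \<mu>. norm x > R2}"
          by (intro \<mu>.finite_measure_mono) (auto simp: R_def)
        with R2(2) have "\<mu>.prob {x\<in>space \<mu>. norm x > R} < d" by simp
        from tail[OF this] show ?thesis
          by (intro order_trans[OF \<mu>.integral_diff_le_tail[where W="\<lambda>x. x" and B="B + d" and d=d and R=R]] Bd Q close)
             (use \<open>d > 0\<close> in auto)
      qed
      ultimately have "dist (\<integral>\<omega>. g (Z n \<omega>) \<partial>M) (\<integral>x. g x \<partial>\<mu>) < d + 2 * (d + (2 * B + 2) * d)"
        using elim(2) by (simp add: dist_real_def)
      also have "\<dots> \<le> d * (2 * (2 * B + 2) + 4)" using \<open>d > 0\<close> by (simp add: algebra_simps)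
      also have "\<dots> \<le> e" by (rule dD)
      finally show ?case .
    qed
  qed
qed

section \<open>Multivariate normal distributions and Slutsky's theorem\<close>

lemma cis_borel_measurable [measurable]: "cis \<in> borel_measurable borel"
  by (intro borel_measurable_continuous_onI continuous_intros)

lemma vec_nth_borel_measurable [measurable]: "(\<lambda>x :: real^'p. x $ i) \<in> borel_measurable borel"
  by (intro borel_measurable_continuous_onI continuous_intros)

text \<open>Read as a polynomial in \<open>s\<close>, this is used in two ways: if the diagonal
  entry is 0 it is affine, which forces the slope to vanish; otherwise its minimum over
  \<open>s\<close> is the quadratic form of the Schur complement.\<close>

lemma quadratic_form_add_axis:
  fixes V :: "real^'p^'p"
  assumes "transpose V = V"
  shows "(t + s *\<^sub>R axis i 1) \<bullet> (V *v (t + s *\<^sub>R axis i 1)) =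
    t \<bullet> (V *v t) + 2 * s * (V $ i \<bullet> t) + s\<^sup>2 * V $ i $ i"
proof -
  have c: "V *v axis i 1 = V $ i"
    using assms by (simp add: matrix_vector_mul_component vec_eq_iff transpose_def inner_axis)
  have "axis i 1 \<bullet> (V *v t) = V $ i \<bullet> t"
    by (simp add: inner_axis' matrix_vector_mul_component)
  moreover have "axis i 1 \<bullet> V $ i = V $ i $ i" by (simp add: inner_axis')
  ultimately show ?thesis
    by (simp add: matrix_vector_right_distrib matrix_vector_mult_scaleR c
        inner_add_left inner_add_right inner_commute power2_eq_square algebra_simps)
qed

lemma psd_zero_diagonal:
  fixes V :: "real^'p^'p"
  assumes "transpose V = V" and psd: "\<And>t. t \<bullet> (V *v t) \<ge> 0" and "V $ i $ i = 0"
  shows "V $ i = 0"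
proof (rule ccontr)
  assume "V $ i \<noteq> 0"
  define t where "t = V $ i"
  have "t \<bullet> t > 0" using \<open>V $ i \<noteq> 0\<close> by (simp add: t_def)
  \<comment> \<open>The form is affine along this line with slope twice
    \<open>t \<bullet> t\<close>; this \<open>s\<close> brings the bound down to the value
    -1.\<close>
  define s where "s = - (t \<bullet> (V *v t) + 1) / (2 * (t \<bullet> t))"
  have "0 \<le> t \<bullet> (V *v t) + 2 * s * (t \<bullet> t)"
    using psd[of "t + s *\<^sub>R axis i 1"] unfolding quadratic_form_add_axis[OF assms(1)]
    using assms(3) by (simp add: t_def)
  also have "\<dots> = -1"
    using \<open>t \<bullet> t > 0\<close> unfolding s_def by (simp add: field_simps)
  finally show False by simp
qed

text \<open>The required law is that of \<open>x + z *\<^sub>R w\<close> with \<open>x\<close>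
  distributed as \<mu>' and an independent standard normal \<open>z\<close>; by Fubini the
  characteristic functions multiply.\<close>

lemma mv_normal_add_rank_one:
  fixes V' :: "real^'p^'p"
  assumes \<mu>': "mv_normal \<mu>' 0 V'"
    and V: "\<And>t. t \<bullet> (V *v t) = t \<bullet> (V' *v t) + (t \<bullet> w)\<^sup>2"
  shows "\<exists>\<mu>. mv_normal \<mu> 0 V"
proof -
  let ?N = "std_normal_distribution"
  define \<mu> where "\<mu> = distr (\<mu>' \<Otimes>\<^sub>M ?N) borel (\<lambda>(x, z). x + z *\<^sub>R w)"
  interpret M': prob_space \<mu>' using \<mu>' by (simp add: mv_normal_def)
  interpret N: real_distribution ?N by (rule real_dist_normal_dist)
  interpret P: pair_prob_space \<mu>' ?N ..
  have [measurable_cong]: "sets \<mu>' = sets borel" using \<mu>' by (simp add: mv_normal_def)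
  have meas: "(\<lambda>(x, z). x + z *\<^sub>R w) \<in> borel_measurable (\<mu>' \<Otimes>\<^sub>M ?N)"
    by measurable
  have "(\<integral>x. cis (t \<bullet> x) \<partial>\<mu>) = complex_of_real (exp (- (t \<bullet> (V *v t)) / 2))" for t
  proof -
    have int: "integrable (\<mu>' \<Otimes>\<^sub>M ?N) (\<lambda>(x, z). cis (t \<bullet> x) * cis (z * (t \<bullet> w)))"
      by (rule P.P.integrable_const_bound[where B=1]) (auto simp: norm_mult case_prod_beta)
    have "(\<integral>x. cis (t \<bullet> x) \<partial>\<mu>) = (\<integral>p. (\<lambda>(x, z). cis (t \<bullet> x) * cis (z * (t \<bullet> w))) p \<partial>(\<mu>' \<Otimes>\<^sub>M ?N))"
      unfolding \<mu>_def using meas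
      by (subst integral_distr) (auto simp: case_prod_beta cis_mult inner_add_right intro!: Bochner_Integration.integral_cong)
    also have "\<dots> = (\<integral>x. (\<integral>z. cis (t \<bullet> x) * cis (z * (t \<bullet> w)) \<partial>?N) \<partial>\<mu>')"
      using P.integral_fst[OF int] by simp
    also have "\<dots> = (\<integral>x. cis (t \<bullet> x) \<partial>\<mu>') * (\<integral>z. cis (z * (t \<bullet> w)) \<partial>?N)"
      by simp
    also have "(\<integral>z. cis (z * (t \<bullet> w)) \<partial>?N) = char ?N (t \<bullet> w)"
      by (simp add: char_def cis_conv_exp mult.commute)
    also have "\<dots> = complex_of_real (exp (- ((t \<bullet> w)\<^sup>2) / 2))"
      by (simp add: char_std_normal_distribution)
    also have "(\<integral>x. cis (t \<bullet> x) \<partial>\<mu>') = complex_of_real (exp (- (t \<bullet> (V' *v t)) / 2))"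
      using \<mu>' by (simp add: mv_normal_def)
    finally show ?thesis
      by (simp add: V of_real_mult[symmetric] exp_add[symmetric] add_divide_distrib diff_divide_distrib
          del: of_real_mult)
  qed
  moreover have "prob_space \<mu>" unfolding \<mu>_def using meas by (rule P.P.prob_space_distr)
  ultimately have "mv_normal \<mu> 0 V" by (simp add: mv_normal_def \<mu>_def)
  then show ?thesis by blast
qed

text \<open>Induction on the number of nonzero diagonal entries: splitting off the rank-one term built from
  a row with \<open>V $ i $ i > 0\<close> makes the \<open>i\<close>-th row vanish.\<close>

lemma mv_normal_exists:
  fixes V :: "real^'p^'p"
  assumes "transpose V = V" "\<And>t. t \<bullet> (V *v t) \<ge> 0"
  shows "\<exists>\<mu>. mv_normal \<mu> 0 V"
  using assms
proof (induction "card {i. V $ i $ i \<noteq> 0}" arbitrary: V rule: less_induct)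
  case less
  note sym = less.prems(1) and psd = less.prems(2)
  show ?case
  proof (cases "\<exists>i. V $ i $ i \<noteq> 0")
    case False
    then have "V $ i = 0" for i using psd_zero_diagonal[OF sym psd] by blast
    then have "V = 0" by (simp add: vec_eq_iff)
    interpret prob_space "return borel (0 :: real^'p)" by (rule prob_space_return) auto
    have "mv_normal (return borel (0 :: real^'p)) 0 V"
      using prob_space_axioms by (simp add: mv_normal_def integral_return \<open>V = 0\<close>)
    then show ?thesis by blast
  next
    case True
    then obtain i where i: "V $ i $ i \<noteq> 0" by blast
    have "V $ i $ i \<ge> 0"
      using psd[of "0 + 1 *\<^sub>R axis i 1"] unfolding quadratic_form_add_axis[OF sym] by simp
    with i have pos: "V $ i $ i > 0" by simp
    \<comment> \<open>The Schur complement of the entry (i, i): the covariance left after regression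
      on the i-th coordinate.\<close>
    define W where "W = (\<chi> a b. V $ a $ b - V $ i $ a * V $ i $ b / V $ i $ i)"
    have Wt: "t \<bullet> (W *v t) = t \<bullet> (V *v t) - (V $ i \<bullet> t)\<^sup>2 / V $ i $ i" for t
    proof -
      have "W *v t = V *v t - ((V $ i \<bullet> t) / V $ i $ i) *\<^sub>R V $ i"
        by (simp add: vec_eq_iff W_def matrix_vector_mult_def inner_vec_def algebra_simps
            sum_subtractf sum_distrib_left sum_divide_distrib)
      then show ?thesis
        by (simp add: inner_diff_right inner_commute power2_eq_square)
    qed
    have "transpose W = W"
      using sym by (auto simp: W_def transpose_def vec_eq_iff mult.commute)
    moreover have "t \<bullet> (W *v t) \<ge> 0" for t
    proof -
      \<comment> \<open>Here \<open>s = - (V $ i \<bullet> t) / V $ i $ i\<close> minimises the form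
        on the line through \<open>t\<close> in direction \<open>axis i 1\<close>, and the minimum
        is the form of \<open>W\<close>.\<close>
      have "0 \<le> t \<bullet> (V *v t) + 2 * (- (V $ i \<bullet> t) / V $ i $ i) * (V $ i \<bullet> t) + (- (V $ i \<bullet> t) / V $ i $ i)\<^sup>2 * V $ i $ i"
        using psd[of "t + (- (V $ i \<bullet> t) / V $ i $ i) *\<^sub>R axis i 1"]
        unfolding quadratic_form_add_axis[OF sym] .
      also have "\<dots> = t \<bullet> (W *v t)"
        unfolding Wt using i by (simp add: field_simps power2_eq_square)
      finally show ?thesis .
    qed
    moreover have "card {a. W $ a $ a \<noteq> 0} < card {a. V $ a $ a \<noteq> 0}"
    proof (intro psubset_card_mono psubsetI)
      \<comment> \<open>A zero diagonal entry of \<open>V\<close> makes its whole row zero, so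
        elimination cannot create a nonzero entry there; the i-th diagonal entry disappears, which
        makes the inclusion strict.\<close>
      show "{a. W $ a $ a \<noteq> 0} \<subseteq> {a. V $ a $ a \<noteq> 0}"
      proof safe
        fix a assume "W $ a $ a \<noteq> 0" and 0: "V $ a $ a = 0"
        then have "V $ a = 0" using psd_zero_diagonal[OF sym psd] by blast
        then have "V $ a $ i = 0" by simp
        then have "V $ i $ a = 0" using sym by (metis transpose_def vec_lambda_beta)
        with 0 \<open>W $ a $ a \<noteq> 0\<close> show False by (simp add: W_def)
      qed
      have "W $ i $ i = 0" using i by (simp add: W_def)
      with i show "{a. W $ a $ a \<noteq> 0} \<noteq> {a. V $ a $ a \<noteq> 0}" by blast
    qed simp
    ultimately obtain \<mu> where "mv_normal \<mu> 0 W" using less.hyps by blast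
    then show ?thesis
    proof (rule mv_normal_add_rank_one)
      fix t
      show "t \<bullet> (V *v t) = t \<bullet> (W *v t) + (t \<bullet> ((1 / sqrt (V $ i $ i)) *\<^sub>R V $ i))\<^sup>2"
        using pos by (simp add: Wt power_divide inner_commute)
    qed
  qed
qed

text \<open>The map \<open>h'\<close> is the adjoint of \<open>h\<close>, passed explicitly. For the
  symmetric matrix in (a) it is the matrix itself, and for the projection onto \<theta> in (b) it is
  padding by zeros.\<close>

lemma mv_normal_linear_image:
  fixes h :: "real^'p \<Rightarrow> real^'q" and h' :: "real^'q \<Rightarrow> real^'p"
  assumes \<mu>: "mv_normal \<mu> 0 V" and [measurable]: "h \<in> borel_measurable borel"
    and adj: "\<And>t x. t \<bullet> h x = h' t \<bullet> x"
    and V': "\<And>t. t \<bullet> (V' *v t) = h' t \<bullet> (V *v h' t)"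
  shows "mv_normal (distr \<mu> borel h) 0 V'"
proof -
  interpret prob_space \<mu> using \<mu> by (simp add: mv_normal_def)
  have [measurable_cong]: "sets \<mu> = sets borel" using \<mu> by (simp add: mv_normal_def)
  have "prob_space (distr \<mu> borel h)" by (rule prob_space_distr) measurable
  then show ?thesis
    using \<mu> by (simp add: mv_normal_def integral_distr adj V')
qed

section \<open>Continuous images and Slutsky's theorem\<close>

lemma conv_distr_continuous_image:
  fixes Z :: "nat \<Rightarrow> 'a \<Rightarrow> 'b::euclidean_space" and h :: "'b \<Rightarrow> 'c::euclidean_space"
  assumes Z: "conv_distr M Z \<mu>" and sets: "sets \<mu> = sets borel" and h: "continuous_on UNIV h"
  shows "conv_distr M (\<lambda>n \<omega>. h (Z n \<omega>)) (distr \<mu> borel h)"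
  unfolding conv_distr_def
proof (intro conjI allI impI)
  have [measurable]: "h \<in> borel_measurable borel" using h by (rule borel_measurable_continuous_onI)
  have [measurable]: "Z n \<in> borel_measurable M" for n using Z by (simp add: conv_distr_def)
  have [measurable_cong]: "sets \<mu> = sets borel" by fact
  show "(\<lambda>\<omega>. h (Z n \<omega>)) \<in> borel_measurable M" for n by measurable
  fix g :: "'c \<Rightarrow> real" assume g: "continuous_on UNIV g \<and> bounded (range g)"
  have [measurable]: "g \<in> borel_measurable borel"
    using g by (auto intro: borel_measurable_continuous_onI)
  obtain B where B: "\<And>x. \<bar>g x\<bar> \<le> B" using g bounded_range_real by metis
  have "continuous_on UNIV (\<lambda>x. g (h x))"
    using g h by (auto intro: continuous_on_compose2)
  from conv_distr_bounded_continuous[OF Z this B]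
  show "(\<lambda>n. LINT \<omega>|M. g (h (Z n \<omega>))) \<longlonglongrightarrow> (LINT x|distr \<mu> borel h. g x)"
    by (simp add: integral_distr)
qed

lemma conv_distr_imp_char:
  fixes Z :: "nat \<Rightarrow> 'a \<Rightarrow> 'b::euclidean_space"
  assumes "prob_space M" "prob_space \<mu>" and sets: "sets \<mu> = sets borel" and Z: "conv_distr M Z \<mu>"
  shows "(\<lambda>n. \<integral>\<omega>. cis (t \<bullet> Z n \<omega>) \<partial>M) \<longlonglongrightarrow> (\<integral>x. cis (t \<bullet> x) \<partial>\<mu>)"
proof -
  interpret M: prob_space M by fact
  interpret \<mu>: prob_space \<mu> by fact
  have [measurable_cong]: "sets \<mu> = sets borel" by fact
  have [measurable]: "Z n \<in> borel_measurable M" for n using Z by (simp add: conv_distr_def)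
  have M_int: "integrable M (\<lambda>\<omega>. cis (t \<bullet> Z n \<omega>))" for n
    by (rule M.integrable_const_bound[where B=1]) auto
  have \<mu>_int: "integrable \<mu> (\<lambda>x. cis (t \<bullet> x))"
    by (rule \<mu>.integrable_const_bound[where B=1]) auto
  have "(\<lambda>n. \<integral>\<omega>. cos (t \<bullet> Z n \<omega>) \<partial>M) \<longlonglongrightarrow> (\<integral>x. cos (t \<bullet> x) \<partial>\<mu>)"
    by (rule conv_distr_bounded_continuous[OF Z, where B=1]) (auto intro!: continuous_intros)
  moreover have "(\<lambda>n. \<integral>\<omega>. sin (t \<bullet> Z n \<omega>) \<partial>M) \<longlonglongrightarrow> (\<integral>x. sin (t \<bullet> x) \<partial>\<mu>)"
    by (rule conv_distr_bounded_continuous[OF Z, where B=1]) (auto intro!: continuous_intros)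
  moreover have "Re (\<integral>\<omega>. cis (t \<bullet> Z n \<omega>) \<partial>M) = (\<integral>\<omega>. cos (t \<bullet> Z n \<omega>) \<partial>M)"
    "Im (\<integral>\<omega>. cis (t \<bullet> Z n \<omega>) \<partial>M) = (\<integral>\<omega>. sin (t \<bullet> Z n \<omega>) \<partial>M)" for n
    using M_int by (simp_all flip: integral_Re integral_Im)
  moreover have "Re (\<integral>x. cis (t \<bullet> x) \<partial>\<mu>) = (\<integral>x. cos (t \<bullet> x) \<partial>\<mu>)"
    "Im (\<integral>x. cis (t \<bullet> x) \<partial>\<mu>) = (\<integral>x. sin (t \<bullet> x) \<partial>\<mu>)"
    using \<mu>_int by (simp_all flip: integral_Re integral_Im)
  ultimately show ?thesis by (simp add: tendsto_complex_iff)
qed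

lemma norm_cis_diff_le: "norm (cis a - cis b) \<le> \<bar>a - b\<bar>"
proof -
  have "cis a - cis b = cis b * (cis (a - b) - 1)"
    by (simp add: algebra_simps cis_mult)
  then have "norm (cis a - cis b) = norm (cis (a - b) - 1)" by (simp add: norm_mult)
  also have "\<dots> \<le> \<bar>a - b\<bar>"
    using iexp_approx1[of "a - b" 0] by (simp add: cis_conv_exp)
  finally show ?thesis .
qed

text \<open>Characteristic functions suffice: \<open>cis (t \<bullet> x)\<close> has modulus 1 and
  is Lipschitz in \<open>x\<close> with constant \<open>norm t\<close>. Splitting according to
  whether the difference exceeds \<open>d\<close> bounds the error by \<open>norm t * d\<close> plus
  twice a vanishing probability.\<close>

theorem slutsky:
  fixes Z W :: "nat \<Rightarrow> 'a \<Rightarrow> 'b::euclidean_space"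
  assumes "prob_space M" "prob_space \<mu>" and sets: "sets \<mu> = sets borel"
    and Z: "conv_distr M Z \<mu>" and WZ: "conv_prob M (\<lambda>n \<omega>. W n \<omega> - Z n \<omega>) 0"
  shows "conv_distr M W \<mu>"
proof (rule levy_continuity_euclidean[OF assms(1-3)])
  interpret M: prob_space M by fact
  have Zm [measurable]: "Z n \<in> borel_measurable M" for n using Z by (simp add: conv_distr_def)
  have D [measurable]: "(\<lambda>\<omega>. W n \<omega> - Z n \<omega>) \<in> borel_measurable M" for n
    using WZ by (simp add: conv_prob_def)
  show W [measurable]: "W n \<in> borel_measurable M" for n
    using borel_measurable_add[OF D[of n] Zm[of n]] by simp
  fix t :: 'b
  have "(\<lambda>n. (\<integral>\<omega>. cis (t \<bullet> W n \<omega>) \<partial>M) - (\<integral>\<omega>. cis (t \<bullet> Z n \<omega>) \<partial>M)) \<longlonglongrightarrow> 0"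
  proof (rule tendstoI)
    fix e :: real assume "e > 0"
    \<comment> \<open>Adding 1 to the norm covers \<open>t = 0\<close>. The Lipschitz part then
      costs at most e/2, and the exceptional event, of probability below e/4, is counted with weight
      2.\<close>
    define d where "d = e / (2 * (norm t + 1))"
    have "norm t + 1 > 0" by (simp add: add_nonneg_pos)
    then have "d > 0" and d: "2 * (norm t + 1) * d = e" using \<open>e > 0\<close> by (auto simp: d_def)
    let ?A = "\<lambda>n. {\<omega>\<in>space M. dist (W n \<omega> - Z n \<omega>) 0 > d}"
    have "(\<lambda>n. M.prob (?A n)) \<longlonglongrightarrow> 0" using WZ \<open>d > 0\<close> by (simp add: conv_prob_def)
    then have "\<forall>\<^sub>F n in sequentially. M.prob (?A n) < e / 4"
      using \<open>e > 0\<close> by (intro order_tendstoD) auto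
    then show "\<forall>\<^sub>F n in sequentially. dist ((\<integral>\<omega>. cis (t \<bullet> W n \<omega>) \<partial>M) - (\<integral>\<omega>. cis (t \<bullet> Z n \<omega>) \<partial>M)) 0 < e"
    proof eventually_elim
      case (elim n)
      have int: "integrable M (\<lambda>\<omega>. cis (t \<bullet> W n \<omega>))" "integrable M (\<lambda>\<omega>. cis (t \<bullet> Z n \<omega>))"
        by (rule M.integrable_const_bound[where B=1]; simp)+
      have Iint: "integrable M (indicator (?A n) :: _ \<Rightarrow> real)"
        by (rule M.integrable_const_bound[where B=1]) auto
      have bound: "norm (cis (t \<bullet> W n \<omega>) - cis (t \<bullet> Z n \<omega>)) \<le> norm t * d + 2 * indicator (?A n) \<omega>"
        if "\<omega> \<in> space M" for \<omega>
      proof (cases "\<omega> \<in> ?A n")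
        case True
        have "norm (cis (t \<bullet> W n \<omega>) - cis (t \<bullet> Z n \<omega>)) \<le> 2"
          using norm_triangle_ineq4[of "cis (t \<bullet> W n \<omega>)" "cis (t \<bullet> Z n \<omega>)"] by simp
        then show ?thesis using True \<open>d > 0\<close> by (simp add: add_increasing)
      next
        case False
        have "norm (cis (t \<bullet> W n \<omega>) - cis (t \<bullet> Z n \<omega>)) \<le> \<bar>t \<bullet> (W n \<omega> - Z n \<omega>)\<bar>"
          using norm_cis_diff_le by (simp add: inner_diff_right)
        also have "\<dots> \<le> norm t * norm (W n \<omega> - Z n \<omega>)" by (rule Cauchy_Schwarz_ineq2)
        also have "\<dots> \<le> norm t * d" using False that by (intro mult_left_mono) auto
        finally show ?thesis using False by simp
      qed
      have "norm ((\<integral>\<omega>. cis (t \<bullet> W n \<omega>) \<partial>M) - (\<integral>\<omega>. cis (t \<bullet> Z n \<omega>) \<partial>M)) =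
          norm (\<integral>\<omega>. cis (t \<bullet> W n \<omega>) - cis (t \<bullet> Z n \<omega>) \<partial>M)"
        using int by simp
      also have "\<dots> \<le> (\<integral>\<omega>. norm (cis (t \<bullet> W n \<omega>) - cis (t \<bullet> Z n \<omega>)) \<partial>M)"
        by (rule integral_norm_bound)
      also have "\<dots> \<le> (\<integral>\<omega>. norm t * d + 2 * indicator (?A n) \<omega> \<partial>M)"
        using bound by (intro integral_mono integrable_norm Bochner_Integration.integrable_diff int
          Bochner_Integration.integrable_add integrable_mult_right Iint) auto
      also have "\<dots> = norm t * d + 2 * M.prob (?A n)"
        using Iint by (subst Bochner_Integration.integral_add) (auto simp: M.prob_space)
      also have "\<dots> < norm t * d + e / 2" using elim by simp
      also have "\<dots> \<le> e" using d \<open>d > 0\<close> by (simp add: algebra_simps)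
      finally show ?case by simp
    qed
  qed
  from tendsto_add[OF this conv_distr_imp_char[OF assms(1-3) Z, of t]]
  show "(\<lambda>n. \<integral>\<omega>. cis (t \<bullet> W n \<omega>) \<partial>M) \<longlonglongrightarrow> (\<integral>x. cis (t \<bullet> x) \<partial>\<mu>)" by simp
qed

section \<open>Central limit theorem for stratified samples\<close>

text \<open>The central limit theorem in use normalizes by a positive standard deviation
  \<open>s\<close>, so its limit is read at \<open>t * s\<close>. If the variance is 0, all summands
  vanish almost surely and the characteristic functions are constantly 1, which agrees with the
  formula.\<close>

lemma (in prob_space) char_normalized_iid_sum:
  fixes X :: "nat \<Rightarrow> 'a \<Rightarrow> real"
  assumes indep: "indep_vars (\<lambda>i. borel) X UNIV"
    and mean: "\<And>n. expectation (X n) = 0"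
    and sq: "\<And>n. integrable M (\<lambda>x. (X n x)\<^sup>2)"
    and distr: "\<And>n. distr M borel (X n) = \<mu>"
    and var: "\<And>n. expectation (\<lambda>x. (X n x)\<^sup>2) = v"
  shows "(\<lambda>n. char (distr M borel (\<lambda>x. (\<Sum>i<n. X i x) / sqrt (real n))) t)
    \<longlonglongrightarrow> complex_of_real (exp (- (t\<^sup>2 * v) / 2))"
proof -
  have [measurable]: "random_variable borel (X n)" for n
    using indep unfolding indep_vars_def2 by simp
  have "v \<ge> 0" using var[of 0] Bochner_Integration.integral_nonneg[of M "\<lambda>x. (X 0 x)\<^sup>2"] by simp
  then consider "v = 0" | "v > 0" by linarith
  then show ?thesis
  proof cases
    case 1
    have "AE x in M. X n x = 0" for n
      using integral_nonneg_eq_0_iff_AE[OF sq[of n]] var[of n] 1 by simp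
    then have "AE x in M. \<forall>n. X n x = 0" by (simp add: AE_all_countable)
    then have "char (distr M borel (\<lambda>x. (\<Sum>i<n. X i x) / sqrt (real n))) t = 1" for n
    proof -
      have "char (distr M borel (\<lambda>x. (\<Sum>i<n. X i x) / sqrt (real n))) t =
          (CLINT x|M. iexp (t * ((\<Sum>i<n. X i x) / sqrt (real n))))"
        by (simp add: char_def integral_distr)
      also have "\<dots> = (CLINT x|M. 1)"
        using \<open>AE x in M. \<forall>n. X n x = 0\<close> by (intro integral_cong_AE) auto
      finally show ?thesis by (simp add: prob_space)
    qed
    then show ?thesis using 1 by simp
  next
    case 2
    define s where "s = sqrt v"
    have s: "s > 0" "s\<^sup>2 = v" using 2 by (auto simp: s_def)
    have "weak_conv_m (\<lambda>n. distr M borel (\<lambda>x. (\<Sum>i<n. X i x) / sqrt (n * s\<^sup>2))) std_normal_distribution"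
      by (rule central_limit_theorem_zero_mean[OF indep mean s(1) sq _ distr]) (simp add: mean var s)
    then have "(\<lambda>n. char (distr M borel (\<lambda>x. (\<Sum>i<n. X i x) / sqrt (n * s\<^sup>2))) (t * s))
        \<longlonglongrightarrow> char std_normal_distribution (t * s)"
      by (intro levy_continuity1 real_dist_normal_dist real_distribution_distr) measurable
    moreover have "char (distr M borel (\<lambda>x. (\<Sum>i<n. X i x) / sqrt (n * s\<^sup>2))) (t * s) =
        char (distr M borel (\<lambda>x. (\<Sum>i<n. X i x) / sqrt (real n))) t" for n
      using s(1) by (simp add: char_def integral_distr real_sqrt_mult)
    ultimately show ?thesis
      by (simp add: char_std_normal_distribution power_mult_distrib s(2))
  qed
qed

section \<open>Second moments and covariance matrices\<close>

lemma square_integrable_component: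
  fixes V :: "'x \<Rightarrow> real^'p"
  assumes [measurable]: "V \<in> borel_measurable P" and "integrable P (\<lambda>x. (norm (V x))\<^sup>2)"
  shows "integrable P (\<lambda>x. (V x $ i)\<^sup>2)"
proof (rule Bochner_Integration.integrable_bound[OF assms(2)])
  show "(\<lambda>x. (V x $ i)\<^sup>2) \<in> borel_measurable P" by measurable
  show "AE x in P. norm ((V x $ i)\<^sup>2) \<le> norm ((norm (V x))\<^sup>2)"
    using component_le_norm_cart by (auto simp: abs_le_square_iff[symmetric])
qed

lemma integrable_square_mult:
  fixes f g :: "'x \<Rightarrow> real"
  assumes [measurable]: "f \<in> borel_measurable P" "g \<in> borel_measurable P"
    and "integrable P (\<lambda>x. (f x)\<^sup>2)" "integrable P (\<lambda>x. (g x)\<^sup>2)"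
  shows "integrable P (\<lambda>x. f x * g x)"
proof (rule Bochner_Integration.integrable_bound)
  show "integrable P (\<lambda>x. (f x)\<^sup>2 + (g x)\<^sup>2)" using assms by simp
  have "\<bar>f x * g x\<bar> \<le> (f x)\<^sup>2 + (g x)\<^sup>2" for x
  proof -
    have "2 * (\<bar>f x\<bar> * \<bar>g x\<bar>) \<le> (f x)\<^sup>2 + (g x)\<^sup>2"
      using sum_squares_bound[of "\<bar>f x\<bar>" "\<bar>g x\<bar>"] by simp
    moreover have "0 \<le> \<bar>f x\<bar> * \<bar>g x\<bar>" by simp
    ultimately show ?thesis unfolding abs_mult by linarith
  qed
  then show "AE x in P. norm (f x * g x) \<le> norm ((f x)\<^sup>2 + (g x)\<^sup>2)" by simp
qed measurable

lemma (in prob_space) square_integrable_centered: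
  fixes f :: "'a \<Rightarrow> real"
  assumes [measurable]: "f \<in> borel_measurable M" and sq: "integrable M (\<lambda>x. (f x)\<^sup>2)"
  shows "integrable M (\<lambda>x. (f x - a)\<^sup>2)"
proof -
  have "integrable M f" by (rule square_integrable_imp_integrable[OF assms])
  then show ?thesis using sq by (simp add: power2_diff)
qed

lemma (in prob_space) covmat_quadratic_form:
  fixes V :: "'a \<Rightarrow> real^'p"
  assumes [measurable]: "V \<in> borel_measurable M" and sq: "integrable M (\<lambda>x. (norm (V x))\<^sup>2)"
  shows "t \<bullet> (covmat M V *v t) = expectation (\<lambda>x. (t \<bullet> V x - t \<bullet> (\<chi> i. expectation (\<lambda>z. V z $ i)))\<^sup>2)"
    and "integrable M (\<lambda>x. (t \<bullet> V x - t \<bullet> (\<chi> i. expectation (\<lambda>z. V z $ i)))\<^sup>2)"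
proof -
  define D where "D i x = V x $ i - expectation (\<lambda>z. V z $ i)" for i x
  have [measurable]: "D i \<in> borel_measurable M" for i unfolding D_def by measurable
  have D: "integrable M (\<lambda>x. D i x * D j x)" for i j
    unfolding D_def using square_integrable_component[OF assms]
    by (intro integrable_square_mult square_integrable_centered) auto
  have eq: "(t \<bullet> V x - t \<bullet> (\<chi> i. expectation (\<lambda>z. V z $ i)))\<^sup>2 =
      (\<Sum>i\<in>UNIV. \<Sum>j\<in>UNIV. t $ i * t $ j * (D i x * D j x))" for x
  proof -
    have "t \<bullet> V x - t \<bullet> (\<chi> i. expectation (\<lambda>z. V z $ i)) = (\<Sum>i\<in>UNIV. t $ i * D i x)"
      by (simp add: inner_vec_def D_def sum_subtractf right_diff_distrib)
    then show ?thesis by (simp add: power2_eq_square sum_product algebra_simps)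
  qed
  show "integrable M (\<lambda>x. (t \<bullet> V x - t \<bullet> (\<chi> i. expectation (\<lambda>z. V z $ i)))\<^sup>2)"
    unfolding eq by (intro Bochner_Integration.integrable_sum integrable_mult_right D)
  have "t \<bullet> (covmat M V *v t) = (\<Sum>i\<in>UNIV. \<Sum>j\<in>UNIV. t $ i * t $ j * expectation (\<lambda>x. D i x * D j x))"
    by (simp add: inner_vec_def matrix_vector_mult_def covmat_def D_def sum_distrib_left algebra_simps)
  also have "\<dots> = expectation (\<lambda>x. \<Sum>i\<in>UNIV. \<Sum>j\<in>UNIV. t $ i * t $ j * (D i x * D j x))"
    using D by (simp add: Bochner_Integration.integral_sum)
  finally show "t \<bullet> (covmat M V *v t) = expectation (\<lambda>x. (t \<bullet> V x - t \<bullet> (\<chi> i. expectation (\<lambda>z. V z $ i)))\<^sup>2)"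
    unfolding eq .
qed

section \<open>Joining independent classes\<close>

lemma matrix_vector_mult_sum_left:
  fixes A :: "'c \<Rightarrow> real^'p^'q"
  shows "(\<Sum>c\<in>S. A c) *v x = (\<Sum>c\<in>S. A c *v x)"
  by (induction S rule: infinite_finite_induct) (auto simp: matrix_vector_mult_add_rdistrib)

text \<open>Independence is inherited along the injection from \<open>i\<close> to
  \<open>(c, i)\<close>; as the index type changes, the argument runs through the families of
  preimages.\<close>

lemma (in prob_space) indep_vars_slice:
  assumes "indep_vars (\<lambda>_. N) (\<lambda>(c, i). Y c i) UNIV"
  shows "indep_vars (\<lambda>_. N) (Y c) UNIV"
proof -
  define E where "E p = {(\<lambda>(c, i). Y c i) p -` A \<inter> space M |A. A \<in> sets N}" for p
  have E: "indep_sets E UNIV" and rv: "\<And>i. random_variable N (Y c i)"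
    using assms unfolding indep_vars_def2 E_def by auto
  have "indep_sets (\<lambda>i. E (c, i)) UNIV"
  proof (rule indep_setsI)
    show "E (c, i) \<subseteq> events" for i using E unfolding indep_sets_def by auto
    fix A J assume J: "J \<noteq> {}" "finite J" and A: "\<forall>j\<in>J. A j \<in> E (c, j)"
    have "prob (\<Inter>p\<in>Pair c ` J. A (snd p)) = (\<Prod>p\<in>Pair c ` J. prob (A (snd p)))"
      using J A by (intro indep_setsD[OF E]) auto
    then show "prob (\<Inter>j\<in>J. A j) = (\<Prod>j\<in>J. prob (A j))"
      by (simp add: prod.reindex inj_on_def image_image)
  qed
  then show ?thesis using rv unfolding indep_vars_def2 E_def by simp
qed

theorem (in prob_space) stratified_central_limit_theorem:
  fixes V :: "'c::finite \<Rightarrow> 'x \<Rightarrow> real^'p" and X :: "'c \<Rightarrow> nat \<Rightarrow> 'a \<Rightarrow> 'x"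
  assumes indep: "indep_vars (\<lambda>_. \<nu>) (\<lambda>(c, i). X c i) UNIV"
    and distr: "\<And>c i. distr M \<nu> (X c i) = P c"
    and Vm [measurable]: "\<And>c. V c \<in> borel_measurable \<nu>"
    and sq: "\<And>c. integrable (P c) (\<lambda>x. (norm (V c x))\<^sup>2)"
    and center: "\<And>k. (\<Sum>c\<in>UNIV. r c * (\<integral>x. V c x $ k \<partial>P c)) = 0"
    and r: "\<And>c. r c > 0"
    and N: "strict_mono N" and m: "\<And>j c. real (m j c) = r c * real (N j)"
    and \<mu>: "mv_normal \<mu> 0 (\<Sum>c\<in>UNIV. r c *\<^sub>R covmat (P c) (V c))"
  shows "conv_distr M (\<lambda>j \<omega>. (1 / sqrt (real (N j))) *\<^sub>R (\<Sum>c\<in>UNIV. \<Sum>i<m j c. V c (X c i \<omega>))) \<mu>"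
proof (rule levy_continuity_euclidean)
  show "prob_space M" by (rule prob_space_axioms)
  show "prob_space \<mu>" "sets \<mu> = sets borel" using \<mu> by (auto simp: mv_normal_def)
  have Xm [measurable]: "X c i \<in> measurable M \<nu>" for c i
    using indep unfolding indep_vars_def2 by (auto dest: spec[of _ "(c, i)"])
  show "(\<lambda>\<omega>. (1 / sqrt (real (N j))) *\<^sub>R (\<Sum>c\<in>UNIV. \<Sum>i<m j c. V c (X c i \<omega>))) \<in> borel_measurable M" for j
    by measurable
  fix t :: "real^'p"
  interpret P: prob_space "P c" for c
    unfolding distr[of c 0, symmetric] by (rule prob_space_distr) measurable
  have [measurable_cong]: "sets (P c) = sets \<nu>" for c
    unfolding distr[of c 0, symmetric] by simp
  define b where "b c = t \<bullet> (\<chi> k. \<integral>x. V c x $ k \<partial>P c)" for c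
  define h where "h c x = t \<bullet> V c x - b c" for c x
  define Y where "Y c i \<omega> = h c (X c i \<omega>)" for c i \<omega>
  define v where "v c = t \<bullet> (covmat (P c) (V c) *v t)" for c
  have hm [measurable]: "h c \<in> borel_measurable \<nu>" for c unfolding h_def by measurable
  have Ym [measurable]: "Y c i \<in> borel_measurable M" for c i unfolding Y_def by measurable
  have VP: "V c \<in> borel_measurable (P c)" for c by measurable
  have h_sq: "integrable (P c) (\<lambda>x. (h c x)\<^sup>2)" "(\<integral>x. (h c x)\<^sup>2 \<partial>P c) = v c" for c
    using P.covmat_quadratic_form[OF VP sq, where t = t] unfolding h_def b_def v_def by auto
  have V_int: "integrable (P c) (\<lambda>x. V c x $ k)" for c k
    by (rule P.square_integrable_imp_integrable[OF _ square_integrable_component[OF VP sq]]) measurable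
  have "(\<integral>x. t \<bullet> V c x \<partial>P c) = b c" for c
    using V_int by (simp add: inner_vec_def b_def)
  moreover have "integrable (P c) (\<lambda>x. t \<bullet> V c x)" for c
    using V_int by (simp add: inner_vec_def)
  ultimately have h_mean: "(\<integral>x. h c x \<partial>P c) = 0" for c
    by (simp add: h_def P.prob_space)
  have Y_mean: "expectation (Y c i) = 0" for c i
    using h_mean[of c] unfolding distr[of c i, symmetric] by (simp add: integral_distr Y_def[abs_def])
  have Y_sq: "integrable M (\<lambda>\<omega>. (Y c i \<omega>)\<^sup>2)" "expectation (\<lambda>\<omega>. (Y c i \<omega>)\<^sup>2) = v c" for c i
    using h_sq[of c] unfolding distr[of c i, symmetric]
    by (simp_all add: integral_distr integrable_distr_eq Y_def[abs_def])
  have Y_distr: "distr M borel (Y c i) = distr (P c) borel (h c)" for c i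
    unfolding distr[of c i, symmetric] by (subst distr_distr) (auto simp: Y_def[abs_def] comp_def)
  have Y_indep: "indep_vars (\<lambda>_. borel) (\<lambda>(c, i). Y c i) UNIV"
    using indep_vars_compose2[OF indep, of "\<lambda>(c, i). h c" "\<lambda>_. borel"]
    by (auto simp: Y_def[abs_def] case_prod_beta')
  have Y_indep_class: "indep_vars (\<lambda>_. borel) (Y c) UNIV" for c
    by (rule indep_vars_slice[OF Y_indep])
  have b_sum: "(\<Sum>c\<in>UNIV. r c * b c) = 0"
  proof -
    have "(\<Sum>c\<in>UNIV. r c * b c) = (\<Sum>c\<in>UNIV. \<Sum>k\<in>UNIV. t $ k * (r c * (\<integral>x. V c x $ k \<partial>P c)))"
      by (simp add: b_def inner_vec_def sum_distrib_left algebra_simps)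
    also have "\<dots> = (\<Sum>k\<in>UNIV. t $ k * (\<Sum>c\<in>UNIV. r c * (\<integral>x. V c x $ k \<partial>P c)))"
      by (subst sum.swap) (simp add: sum_distrib_left)
    finally show ?thesis by (simp add: center)
  qed
  \<comment> \<open>In class c the normalization by \<open>sqrt (real (N j))\<close> is
    \<open>sqrt (r c)\<close> times the normalization by the class's own sample size, since
    \<open>m j c\<close> equals \<open>r c * N j\<close>. This is the origin of the argument
    \<open>sqrt (r c)\<close>.\<close>
  define F where "F c n = char (distr M borel (\<lambda>\<omega>. (\<Sum>i<n. Y c i \<omega>) / sqrt (real n))) (sqrt (r c))" for c n
  have char_eq: "(\<integral>\<omega>. cis (t \<bullet> ((1 / sqrt (real (N j))) *\<^sub>R (\<Sum>c\<in>UNIV. \<Sum>i<m j c. V c (X c i \<omega>)))) \<partial>M)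
      = (\<Prod>c\<in>UNIV. F c (m j c))" for j
  proof -
    let ?I = "Sigma UNIV (\<lambda>c. {..<m j c})"
    define Y' where "Y' c i \<omega> = Y c i \<omega> / sqrt (real (N j))" for c i \<omega>
    have Y'_indep: "indep_vars (\<lambda>_. borel) (\<lambda>(c, i). Y' c i) UNIV"
      using indep_vars_compose2[OF Y_indep, of "\<lambda>_ y. y / sqrt (real (N j))" "\<lambda>_. borel"]
      by (auto simp: Y'_def[abs_def] case_prod_beta')
    have Y'_indep_class: "indep_vars (\<lambda>_. borel) (Y' c) UNIV" for c
      using indep_vars_compose2[OF Y_indep_class, of "\<lambda>_ y. y / sqrt (real (N j))" "\<lambda>_. borel" c]
      by (auto simp: Y'_def[abs_def])
    have sum_eq: "t \<bullet> ((1 / sqrt (real (N j))) *\<^sub>R (\<Sum>c\<in>UNIV. \<Sum>i<m j c. V c (X c i \<omega>)))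
        = (\<Sum>p\<in>?I. (\<lambda>(c, i). Y' c i) p \<omega>)" for \<omega>
    proof -
      have "(\<Sum>p\<in>?I. (\<lambda>(c, i). Y' c i) p \<omega>) = (\<Sum>c\<in>UNIV. \<Sum>i<m j c. Y' c i \<omega>)"
        by (subst sum.Sigma) (auto simp: case_prod_beta)
      also have "\<dots> = (\<Sum>c\<in>UNIV. \<Sum>i<m j c. t \<bullet> V c (X c i \<omega>) - b c) / sqrt (real (N j))"
        by (simp add: Y'_def Y_def h_def sum_divide_distrib)
      \<comment> \<open>Centring subtracts \<open>m j c * b c\<close> in class c. With exact class
        sizes the total is \<open>N j\<close> times the weighted sum of the \<open>b c\<close>,
        which is 0, so the centred and the original statistic coincide.\<close>
      also have "(\<Sum>c\<in>UNIV. \<Sum>i<m j c. t \<bullet> V c (X c i \<omega>) - b c) =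
          (\<Sum>c\<in>UNIV. \<Sum>i<m j c. t \<bullet> V c (X c i \<omega>)) - real (N j) * (\<Sum>c\<in>UNIV. r c * b c)"
        by (simp add: sum_subtractf m sum_distrib_left algebra_simps)
      finally show ?thesis by (simp add: b_sum inner_sum_right)
    qed
    have "(\<integral>\<omega>. cis (t \<bullet> ((1 / sqrt (real (N j))) *\<^sub>R (\<Sum>c\<in>UNIV. \<Sum>i<m j c. V c (X c i \<omega>)))) \<partial>M)
        = char (distr M borel (\<lambda>\<omega>. \<Sum>p\<in>?I. (\<lambda>(c, i). Y' c i) p \<omega>)) 1"
      unfolding sum_eq by (simp add: char_def integral_distr cis_conv_exp case_prod_beta Y'_def)
    \<comment> \<open>Independence over all pairs splits the characteristic function completely;
      afterwards the factors of each class are multiplied back together, because the limit theorem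
      speaks of class sums.\<close>
    also have "\<dots> = (\<Prod>p\<in>?I. char (distr M borel ((\<lambda>(c, i). Y' c i) p)) 1)"
      by (rule char_distr_sum[OF indep_vars_subset[OF Y'_indep]]) simp
    also have "\<dots> = (\<Prod>c\<in>UNIV. \<Prod>i<m j c. char (distr M borel (Y' c i)) 1)"
      by (subst prod.Sigma) (auto simp: case_prod_beta)
    also have "\<dots> = (\<Prod>c\<in>UNIV. char (distr M borel (\<lambda>\<omega>. \<Sum>i<m j c. Y' c i \<omega>)) 1)"
      by (intro prod.cong refl char_distr_sum[symmetric] indep_vars_subset[OF Y'_indep_class]) simp
    also have "\<dots> = (\<Prod>c\<in>UNIV. F c (m j c))"
    proof (intro prod.cong refl)
      fix c
      have "(\<Sum>i<m j c. Y' c i \<omega>) = sqrt (r c) * ((\<Sum>i<m j c. Y c i \<omega>) / sqrt (real (m j c)))" for \<omega>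
        using r[of c] by (simp add: Y'_def sum_divide_distrib[symmetric] m real_sqrt_mult)
      then show "char (distr M borel (\<lambda>\<omega>. \<Sum>i<m j c. Y' c i \<omega>)) 1 = F c (m j c)"
        by (simp add: F_def char_def integral_distr)
    qed
    finally show ?thesis .
  qed
  have "(\<lambda>j. F c (m j c)) \<longlonglongrightarrow> complex_of_real (exp (- (r c * v c) / 2))" for c
  proof -
    have "F c \<longlonglongrightarrow> complex_of_real (exp (- ((sqrt (r c))\<^sup>2 * v c) / 2))"
      unfolding F_def by (rule char_normalized_iid_sum[OF Y_indep_class Y_mean Y_sq(1) Y_distr Y_sq(2)])
    moreover have "filterlim (\<lambda>j. m j c) at_top at_top"
    proof -
      have "filterlim (\<lambda>j. r c * real (N j)) at_top at_top"
        using r by (intro filterlim_tendsto_pos_mult_at_top[OF tendsto_const]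
            filterlim_compose[OF filterlim_real_sequentially] filterlim_subseq N)
      then show ?thesis
        unfolding m[symmetric] by (simp add: filterlim_sequentially_iff_filterlim_real)
    qed
    ultimately show ?thesis using r[of c] filterlim_compose by fastforce
  qed
  then have "(\<lambda>j. \<Prod>c\<in>UNIV. F c (m j c)) \<longlonglongrightarrow> (\<Prod>c\<in>UNIV. complex_of_real (exp (- (r c * v c) / 2)))"
    by (intro tendsto_prod) auto
  also have "(\<Prod>c\<in>UNIV. complex_of_real (exp (- (r c * v c) / 2))) =
      complex_of_real (exp (- (\<Sum>c\<in>UNIV. r c * v c) / 2))"
    by (simp add: exp_sum[symmetric] sum_negf sum_divide_distrib flip: of_real_prod)
  also have "(\<Sum>c\<in>UNIV. r c * v c) = t \<bullet> ((\<Sum>c\<in>UNIV. r c *\<^sub>R covmat (P c) (V c)) *v t)"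
    by (simp add: matrix_vector_mult_sum_left inner_sum_right v_def scaleR_matrix_vector_assoc[symmetric])
  finally show "(\<lambda>j. \<integral>\<omega>. cis (t \<bullet> ((1 / sqrt (real (N j))) *\<^sub>R (\<Sum>c\<in>UNIV. \<Sum>i<m j c. V c (X c i \<omega>)))) \<partial>M)
      \<longlonglongrightarrow> (\<integral>x. cis (t \<bullet> x) \<partial>\<mu>)"
    unfolding char_eq using \<mu> by (simp add: mv_normal_def)
qed

section \<open>Calculus\<close>

lemma frechet_derivative_eqI:
  "(f has_derivative f') (at v) \<Longrightarrow> frechet_derivative f (at v) = f'"
  by (rule frechet_derivative_at[symmetric])

text \<open>Needed because the product, exponential and reciprocal rules express a derivative
  through the function itself, which must then be available one order lower.\<close>

lemma Ck_Suc_imp_Ck: "Ck (Suc k) f \<Longrightarrow> Ck k f"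
proof (induction k arbitrary: f)
  case 0
  then show ?case
    by (auto simp: continuous_on_eq_continuous_at intro: differentiable_imp_continuous_within)
next
  case (Suc k)
  from Suc.prems Suc.IH show ?case by (simp only: Ck.simps(2)) blast
qed

lemma Ck_const: "Ck k (\<lambda>v. c)"
proof (induction k arbitrary: c)
  case (Suc k)
  have "frechet_derivative (\<lambda>v. c) (at v) = (\<lambda>h. 0)" for v :: "real^'a"
    by (rule frechet_derivative_const)
  with Suc show ?case by simp
qed simp

lemma Ck_add: "Ck k f \<Longrightarrow> Ck k g \<Longrightarrow> Ck k (\<lambda>v. f v + g v)"
proof (induction k arbitrary: f g)
  case (Suc k)
  have "frechet_derivative (\<lambda>v. f v + g v) (at v) =
      (\<lambda>h. frechet_derivative f (at v) h + frechet_derivative g (at v) h)" for v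
    using Suc.prems by (intro frechet_derivative_eqI has_derivative_add) (auto simp: frechet_derivative_works)
  with Suc show ?case by simp
qed (auto intro: continuous_intros)

lemma Ck_mult: "Ck k f \<Longrightarrow> Ck k g \<Longrightarrow> Ck k (\<lambda>v. f v * g v)"
proof (induction k arbitrary: f g)
  case (Suc k)
  have "frechet_derivative (\<lambda>v. f v * g v) (at v) =
      (\<lambda>h. f v * frechet_derivative g (at v) h + frechet_derivative f (at v) h * g v)" for v
    using Suc.prems by (intro frechet_derivative_eqI has_derivative_mult) (auto simp: frechet_derivative_works)
  with Suc.prems Ck_Suc_imp_Ck[OF Suc.prems(1)] Ck_Suc_imp_Ck[OF Suc.prems(2)] show ?case
    by (simp add: Ck_add Suc.IH)
qed (auto intro: continuous_intros)

lemma Ck_sum: "(\<And>i. i \<in> A \<Longrightarrow> Ck k (f i)) \<Longrightarrow> Ck k (\<lambda>v. \<Sum>i\<in>A. f i v)"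
  by (induction A rule: infinite_finite_induct) (auto intro: Ck_const Ck_add)

lemma Ck_uminus: "Ck k f \<Longrightarrow> Ck k (\<lambda>v. - f v)"
  using Ck_mult[OF Ck_const[of k "- 1"]] by simp

lemma Ck_diff: "Ck k f \<Longrightarrow> Ck k g \<Longrightarrow> Ck k (\<lambda>v. f v - g v)"
  using Ck_add[OF _ Ck_uminus] by simp

lemma frechet_derivative_real_compose:
  fixes f :: "real^'p \<Rightarrow> real"
  assumes "f differentiable (at v)" "(\<phi> has_real_derivative d) (at (f v))"
  shows "frechet_derivative (\<lambda>v. \<phi> (f v)) (at v) = (\<lambda>h. d * frechet_derivative f (at v) h)"
    and "(\<lambda>v. \<phi> (f v)) differentiable (at v)"
proof -
  have "((\<lambda>v. \<phi> (f v)) has_derivative (\<lambda>h. d * frechet_derivative f (at v) h)) (at v)"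
    using has_derivative_compose[of f _ v UNIV \<phi>] assms
    by (simp add: frechet_derivative_works has_field_derivative_def)
  then show "frechet_derivative (\<lambda>v. \<phi> (f v)) (at v) = (\<lambda>h. d * frechet_derivative f (at v) h)"
    "(\<lambda>v. \<phi> (f v)) differentiable (at v)"
    by (auto intro: frechet_derivative_eqI simp: differentiable_def)
qed

lemma Ck_exp: "Ck k f \<Longrightarrow> Ck k (\<lambda>v. exp (f v))"
proof (induction k arbitrary: f)
  case (Suc k)
  have D: "f differentiable (at v)" for v using Suc.prems by simp
  show ?case
    using Suc.prems Suc.IH[OF Ck_Suc_imp_Ck[OF Suc.prems]]
    by (simp add: frechet_derivative_real_compose[OF D DERIV_exp] Ck_mult)
qed (auto intro: continuous_intros)

lemma Ck_inverse: "Ck k f \<Longrightarrow> (\<And>v. f v \<noteq> 0) \<Longrightarrow> Ck k (\<lambda>v. inverse (f v))"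
proof (induction k arbitrary: f)
  case (Suc k)
  have D: "f differentiable (at v)" for v using Suc.prems by simp
  have I: "(inverse has_real_derivative - (inverse (f v) * inverse (f v))) (at (f v))" for v
    using DERIV_inverse[OF Suc.prems(2), of v UNIV] by (simp add: numeral_2_eq_2)
  show ?case
    using Suc.prems(1) Suc.IH[OF Ck_Suc_imp_Ck[OF Suc.prems(1)] Suc.prems(2)]
    by (simp add: frechet_derivative_real_compose[OF D I] Ck_mult Ck_uminus)
qed (auto intro: continuous_intros)

lemma Ck_ln:
  assumes "Ck k f" "\<And>v. f v > 0"
  shows "Ck k (\<lambda>v. ln (f v))"
proof (cases k)
  case 0
  have "f v \<noteq> 0" for v using assms(2)[of v] by simp
  with 0 assms show ?thesis by (auto intro: continuous_intros)
next
  case (Suc l)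
  have D: "f differentiable (at v)" for v using assms Suc by simp
  have I: "(ln has_real_derivative inverse (f v)) (at (f v))" for v
    by (rule DERIV_ln[OF assms(2)])
  have "f v \<noteq> 0" for v using assms(2)[of v] by simp
  then have "Ck l (\<lambda>v. inverse (f v))"
    using Ck_Suc_imp_Ck[of l f] assms(1) Suc by (intro Ck_inverse) auto
  then show ?thesis
    using assms(1) unfolding Suc
    by (simp add: frechet_derivative_real_compose[OF D I] Ck_mult)
qed

lemma axis_expansion: "h = (\<Sum>j\<in>UNIV. h $ j *\<^sub>R axis j (1::real))"
  by (simp add: vec_eq_iff axis_def if_distrib cong: if_cong)

text \<open>The chain rule yields derivatives of \<open>f\<close> in the directions
  \<open>h (axis i 1)\<close>; since \<open>Ck\<close> speaks only of coordinate directions, these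
  are expanded with constant coefficients.\<close>

lemma Ck_linear_compose:
  fixes h :: "real^'q \<Rightarrow> real^'p"
  assumes h: "bounded_linear h"
  shows "Ck k f \<Longrightarrow> Ck k (\<lambda>v. f (h v))"
proof (induction k arbitrary: f)
  case 0
  then show ?case
    using h by (auto intro!: continuous_on_compose2[of UNIV f] simp: bounded_linear.linear linear_continuous_on)
next
  case (Suc k)
  have comp: "((\<lambda>v. f (h v)) has_derivative (\<lambda>u. frechet_derivative f (at (h v)) (h u))) (at v)" for v
    using Suc.prems by (intro has_derivative_compose[OF bounded_linear_imp_has_derivative[OF h]])
      (auto simp: frechet_derivative_works)
  have "frechet_derivative f (at (h v)) (h u) =
      (\<Sum>j\<in>UNIV. h u $ j * frechet_derivative f (at (h v)) (axis j 1))" for u v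
  proof -
    have "linear (frechet_derivative f (at (h v)))"
      using Suc.prems by (intro linear_frechet_derivative) auto
    then show ?thesis
      by (subst axis_expansion) (simp add: linear_sum linear_cmul)
  qed
  then have "frechet_derivative (\<lambda>v. f (h v)) (at v) (axis i 1) =
      (\<Sum>j\<in>UNIV. h (axis i 1) $ j * frechet_derivative f (at (h v)) (axis j 1))" for i v
    by (simp add: frechet_derivative_eqI[OF comp])
  moreover have "(\<lambda>v. f (h v)) differentiable (at v)" for v
    using comp unfolding differentiable_def by blast
  moreover have "Ck k (\<lambda>v. frechet_derivative f (at (h v)) (axis j 1))" for j
    using Suc.prems Suc.IH[of "\<lambda>w. frechet_derivative f (at w) (axis j 1)"] by simp
  ultimately show ?case by (simp add: Ck_sum Ck_mult Ck_const)
qed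

lemma Ck_linear:
  fixes f :: "real^'p \<Rightarrow> real"
  assumes f: "bounded_linear f"
  shows "Ck k f"
proof (cases k)
  case 0
  then show ?thesis using f by (simp add: linear_continuous_on)
next
  case (Suc l)
  have f': "(f has_derivative f) (at v)" for v by (rule bounded_linear_imp_has_derivative[OF f])
  then show ?thesis
    using Suc by (auto simp: frechet_derivative_eqI[OF f'] Ck_const differentiable_def)
qed

section \<open>Gradients, Hessians and the integral remainder\<close>

lemma has_derivative_grad:
  fixes f :: "real^'p \<Rightarrow> real"
  assumes "f differentiable (at v)"
  shows "(f has_derivative (\<lambda>h. h \<bullet> grad f v)) (at v)"
proof -
  have f: "(f has_derivative frechet_derivative f (at v)) (at v)"
    using assms by (simp add: frechet_derivative_works)
  have "frechet_derivative f (at v) h = h \<bullet> grad f v" for h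
  proof -
    have "linear (frechet_derivative f (at v))"
      using assms by (rule linear_frechet_derivative)
    then have "frechet_derivative f (at v) h = (\<Sum>j\<in>UNIV. h $ j * frechet_derivative f (at v) (axis j 1))"
      by (subst axis_expansion) (simp add: linear_sum linear_cmul)
    then show ?thesis by (simp add: inner_vec_def grad_def)
  qed
  then have "frechet_derivative f (at v) = (\<lambda>h. h \<bullet> grad f v)" by blast
  with f show ?thesis by simp
qed

lemma grad_nth_eqI:
  "(f has_derivative f') (at v) \<Longrightarrow> grad f v $ i = f' (axis i 1)"
  by (simp add: grad_def frechet_derivative_eqI)

lemma hess_nth: "hess f v $ i $ j = grad (\<lambda>w. grad f w $ j) v $ i"
  by (simp add: hess_def grad_def)

lemma Ck_2_grad:
  assumes "Ck 2 f"
  shows "f differentiable (at v)" "(\<lambda>w. grad f w $ j) differentiable (at v)"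
    "continuous_on UNIV (\<lambda>v. hess f v $ i $ j)"
  using assms by (auto simp: numeral_2_eq_2 grad_def hess_def)

lemma grad_sum:
  assumes "\<And>i. i \<in> A \<Longrightarrow> f i differentiable (at v)"
  shows "grad (\<lambda>v. \<Sum>i\<in>A. f i v) v = (\<Sum>i\<in>A. grad (f i) v)"
proof -
  have "((\<lambda>v. \<Sum>i\<in>A. f i v) has_derivative (\<lambda>h. \<Sum>i\<in>A. h \<bullet> grad (f i) v)) (at v)"
    using assms by (intro has_derivative_sum has_derivative_grad)
  then show ?thesis by (simp add: vec_eq_iff grad_nth_eqI inner_axis' sum_component)
qed

text \<open>Differentiating \<open>\<Sum>\<^sub>c exp (L c) = 1\<close> once and twice.\<close>

lemma score_identity:
  fixes L :: "'c::finite \<Rightarrow> real^'p \<Rightarrow> real"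
  assumes L: "\<And>c v. L c differentiable (at v)" and sum1: "\<And>v. (\<Sum>c\<in>UNIV. exp (L c v)) = 1"
  shows "(\<Sum>c\<in>UNIV. exp (L c v) * grad (L c) v $ j) = 0"
proof -
  have "((\<lambda>v. \<Sum>c\<in>UNIV. exp (L c v)) has_derivative
      (\<lambda>h. \<Sum>c\<in>UNIV. exp (L c v) * (h \<bullet> grad (L c) v))) (at v)"
    using has_derivative_grad[OF L]
    by (auto intro!: derivative_eq_intros simp: mult.commute)
  moreover have "((\<lambda>v. \<Sum>c\<in>UNIV. exp (L c v)) has_derivative (\<lambda>h. 0)) (at v)"
    unfolding sum1 by (rule has_derivative_const)
  ultimately have "(\<lambda>h. \<Sum>c\<in>UNIV. exp (L c v) * (h \<bullet> grad (L c) v)) = (\<lambda>h. 0)"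
    by (rule has_derivative_unique)
  from fun_cong[OF this, of "axis j 1"] show ?thesis by (simp add: inner_axis')
qed

lemma information_identity:
  fixes L :: "'c::finite \<Rightarrow> real^'p \<Rightarrow> real"
  assumes L: "\<And>c. Ck 2 (L c)" and sum1: "\<And>v. (\<Sum>c\<in>UNIV. exp (L c v)) = 1"
  shows "(\<Sum>c\<in>UNIV. exp (L c v) * (hess (L c) v $ i $ j + grad (L c) v $ i * grad (L c) v $ j)) = 0"
proof -
  have "((\<lambda>v. \<Sum>c\<in>UNIV. exp (L c v) * grad (L c) v $ j) has_derivative
      (\<lambda>h. \<Sum>c\<in>UNIV. exp (L c v) * (h \<bullet> grad (\<lambda>w. grad (L c) w $ j) v) +
        (exp (L c v) * (h \<bullet> grad (L c) v)) * grad (L c) v $ j)) (at v)"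
  proof (intro has_derivative_sum has_derivative_mult has_derivative_grad[OF Ck_2_grad(2)[OF L]])
    show "((\<lambda>v. exp (L c v)) has_derivative (\<lambda>h. exp (L c v) * (h \<bullet> grad (L c) v))) (at v)" for c
      using has_derivative_grad[OF Ck_2_grad(1)[OF L]]
      by (auto intro!: derivative_eq_intros simp: mult.commute)
  qed
  moreover have "((\<lambda>v. \<Sum>c\<in>UNIV. exp (L c v) * grad (L c) v $ j) has_derivative (\<lambda>h. 0)) (at v)"
    unfolding score_identity[OF Ck_2_grad(1)[OF L] sum1] by (rule has_derivative_const)
  ultimately have "(\<lambda>h. \<Sum>c\<in>UNIV. exp (L c v) * (h \<bullet> grad (\<lambda>w. grad (L c) w $ j) v) +
        (exp (L c v) * (h \<bullet> grad (L c) v)) * grad (L c) v $ j) = (\<lambda>h. 0)"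
    by (rule has_derivative_unique)
  from fun_cong[OF this, of "axis i 1"] show ?thesis
    by (simp add: inner_axis' hess_nth algebra_simps)
qed

text \<open>The fundamental theorem of calculus along the segment, for each component of the
  gradient. A mean-value form would need a different intermediate point for each component; the
  integral gives one matrix, the one in (N3). The product \<open>v*\<close> appears because the
  first index of \<open>hess\<close> is the direction of differentiation.\<close>

lemma grad_integral_hess:
  fixes f :: "real^'p \<Rightarrow> real"
  assumes f: "Ck 2 f"
  shows "grad f w = grad f v + (w - v) v* integral {0..1} (\<lambda>t. hess f (v + t *\<^sub>R (w - v)))"
proof -
  define d where "d = w - v"
  define H where "H t = hess f (v + t *\<^sub>R d)" for t
  have cont: "continuous_on {0..1} (\<lambda>t. H t $ i $ j)" for i j
    unfolding H_def
    by (intro continuous_on_compose2[OF Ck_2_grad(3)[OF f]] continuous_intros) auto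
  then have Hcont: "continuous_on {0..1} H"
    by (simp add: continuous_on_componentwise[of _ H] Basis_vec_def inner_axis)
  then have Hint: "H integrable_on {0..1}" by (rule integrable_continuous_real)
  have "grad f w $ j - grad f v $ j = (d v* integral {0..1} H) $ j" for j
  proof -
    have "((\<lambda>t. grad f (v + t *\<^sub>R d) $ j) has_vector_derivative (\<Sum>i\<in>UNIV. d $ i * H t $ i $ j)) (at t within {0..1})" for t
    proof -
      have "((\<lambda>t. grad f (v + t *\<^sub>R d) $ j) has_derivative
          (\<lambda>s. (s *\<^sub>R d) \<bullet> grad (\<lambda>w. grad f w $ j) (v + t *\<^sub>R d))) (at t within {0..1})"
        by (rule has_derivative_compose[OF _ has_derivative_grad[OF Ck_2_grad(2)[OF f]]])
          (auto intro!: derivative_eq_intros)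
      then show ?thesis
        by (simp add: has_vector_derivative_def H_def hess_nth inner_vec_def sum_distrib_left mult.assoc)
    qed
    then have "((\<lambda>t. \<Sum>i\<in>UNIV. d $ i * H t $ i $ j) has_integral
        grad f (v + 1 *\<^sub>R d) $ j - grad f (v + 0 *\<^sub>R d) $ j) {0..1}"
      by (intro fundamental_theorem_of_calculus) auto
    moreover have "((\<lambda>t. \<Sum>i\<in>UNIV. d $ i * H t $ i $ j) has_integral
        (\<Sum>i\<in>UNIV. d $ i * integral {0..1} H $ i $ j)) {0..1}"
    proof (intro has_integral_sum has_integral_mult_right)
      fix i
      have "bounded_linear (\<lambda>A :: real^'p^'p. A $ i $ j)"
        by (intro bounded_linear_compose[OF bounded_linear_vec_nth] bounded_linear_vec_nth)
      from has_integral_linear[OF integrable_integral[OF Hint] this]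
      show "((\<lambda>t. H t $ i $ j) has_integral integral {0..1} H $ i $ j) {0..1}"
        by (simp add: comp_def)
    qed simp
    ultimately have "grad f (v + 1 *\<^sub>R d) $ j - grad f (v + 0 *\<^sub>R d) $ j =
        (\<Sum>i\<in>UNIV. d $ i * integral {0..1} H $ i $ j)"
      by (rule has_integral_unique)
    then show ?thesis by (simp add: d_def vector_matrix_mult_def mult.commute)
  qed
  then show ?thesis
    by (simp add: vec_eq_iff d_def[symmetric] H_def[symmetric] diff_eq_eq add.commute)
qed

section \<open>Measurability of derivatives in the observation\<close>

lemma frechet_derivative_measurable:
  fixes F :: "'b::real_normed_vector \<Rightarrow> 'x \<Rightarrow> real"
  assumes F: "\<And>v. F v \<in> borel_measurable N"
    and D: "\<And>x. x \<in> space N \<Longrightarrow> (\<lambda>v. F v x) differentiable (at v)"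
  shows "(\<lambda>x. frechet_derivative (\<lambda>v. F v x) (at v) e) \<in> borel_measurable N"
proof (rule borel_measurable_LIMSEQ_real)
  let ?h = "\<lambda>n. inverse (real (Suc n))"
  \<comment> \<open>Difference quotients along a fixed null sequence are measurable, and
    differentiability makes them converge pointwise to the directional derivative.\<close>
  show "(\<lambda>x. (F (v + ?h n *\<^sub>R e) x - F v x) / ?h n) \<in> borel_measurable N" for n
    using F by (intro borel_measurable_divide borel_measurable_diff) auto
  fix x assume "x \<in> space N"
  let ?F = "frechet_derivative (\<lambda>v. F v x) (at v)"
  have der: "((\<lambda>v. F v x) has_derivative ?F) (at v)"
    using D[OF \<open>x \<in> space N\<close>] by (simp add: frechet_derivative_works)
  have "((\<lambda>t. F (v + t *\<^sub>R e) x) has_derivative (\<lambda>s. ?F (s *\<^sub>R e))) (at 0)"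
    using der by (intro has_derivative_compose[where f = "\<lambda>t. v + t *\<^sub>R e" and g = "\<lambda>v. F v x"])
      (auto intro!: derivative_eq_intros)
  moreover have "?F (s *\<^sub>R e) = ?F e * s" for s
    using has_derivative_linear[OF der] by (simp add: linear_cmul)
  ultimately have "((\<lambda>t. F (v + t *\<^sub>R e) x) has_real_derivative ?F e) (at 0)"
    by (simp add: has_field_derivative_def)
  then have "((\<lambda>h. (F (v + (0 + h) *\<^sub>R e) x - F (v + 0 *\<^sub>R e) x) / h) \<longlongrightarrow> ?F e) (at 0)"
    by (simp add: DERIV_def)
  moreover have "filterlim ?h (at 0) sequentially"
    using LIMSEQ_inverse_real_of_nat by (simp add: filterlim_at del: of_nat_Suc)
  ultimately show "(\<lambda>n. (F (v + ?h n *\<^sub>R e) x - F v x) / ?h n) \<longlonglongrightarrow> ?F e"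
    by (auto dest: filterlim_compose)
qed

section \<open>Linearization of estimating equations\<close>

lemma matrix_inv_inverse:
  assumes "invertible A"
  shows "A ** matrix_inv A = mat 1" "matrix_inv A ** A = mat 1"
proof -
  have "\<exists>B. A ** B = mat 1 \<and> B ** A = mat 1" using assms by (simp add: invertible_def)
  then have "A ** matrix_inv A = mat 1 \<and> matrix_inv A ** A = mat 1"
    unfolding matrix_inv_def by (rule someI_ex)
  then show "A ** matrix_inv A = mat 1" "matrix_inv A ** A = mat 1" by auto
qed

lemma pos_def_invertible: "pos_def A \<Longrightarrow> invertible A"
proof -
  assume A: "pos_def A"
  have "A *v x = 0 \<Longrightarrow> x = 0" for x
    using A unfolding pos_def_def by (metis inner_zero_right less_irrefl)
  then have "\<exists>B. B ** A = mat 1" unfolding matrix_left_invertible_ker by blast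
  then show "invertible A" unfolding invertible_def using matrix_left_right_inverse by blast
qed

lemma transpose_matrix_inv:
  fixes A :: "real^'p^'p"
  assumes "transpose A = A" "invertible A"
  shows "transpose (matrix_inv A) = matrix_inv A"
proof -
  have "transpose (matrix_inv A) ** A = mat 1"
    using arg_cong[OF matrix_inv_inverse(1)[OF assms(2)], of transpose] assms(1)
    by (simp add: matrix_transpose_mul transpose_mat)
  then have "transpose (matrix_inv A) ** (A ** matrix_inv A) = matrix_inv A"
    by (simp add: matrix_mul_assoc)
  then show ?thesis by (simp add: matrix_inv_inverse(1)[OF assms(2)])
qed

text \<open>Cauchy-Schwarz over the rows. The matrix norm is the Euclidean norm of all entries, the
  one in which \<open>conv_prob\<close> measures the distance of random matrices.\<close>

lemma norm_vector_matrix_mult_le: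
  fixes A :: "real^'q^'p"
  shows "norm (x v* A) \<le> norm x * norm A"
proof -
  have "x v* A = (\<Sum>i\<in>UNIV. x $ i *\<^sub>R A $ i)"
    by (simp add: vec_eq_iff vector_matrix_mult_def mult.commute)
  also have "norm \<dots> \<le> (\<Sum>i\<in>UNIV. \<bar>x $ i\<bar> * norm (A $ i))"
    by (rule order_trans[OF norm_sum]) simp
  also have "\<dots> = (\<Sum>i\<in>UNIV. \<bar>norm (x $ i)\<bar> * \<bar>norm (A $ i)\<bar>)" by simp
  also have "\<dots> \<le> norm x * norm A"
    unfolding norm_vec_def by (rule L2_set_mult_ineq)
  finally show ?thesis .
qed

text \<open>The error R satisfies R = A^-1 (w (A - B) - e), and w is at most the norm of R plus that
  of A^-1 u. Since \<open>K * \<delta> \<le> 1 / 2\<close>, the term containing R on the right is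
  absorbed into the left side.\<close>

lemma linearization_error_bound:
  fixes A B :: "real^'p^'p"
  assumes sym: "transpose A = A" and inv: "invertible A"
    and K: "\<And>x. norm (matrix_inv A *v x) \<le> norm x * K" and "K > 0"
    and u: "norm u \<le> \<rho>" and \<delta>: "norm (B - A) \<le> \<delta>" "K * \<delta> \<le> 1 / 2"
    and e: "u - w v* B = e"
  shows "norm (w - matrix_inv A *v u) \<le> 2 * K * (\<delta> * (\<rho> * K) + norm e)"
proof -
  define R where "R = w - matrix_inv A *v u"
  have "0 \<le> \<delta>" using \<delta>(1) norm_ge_zero order_trans by blast
  have "w v* A = A *v w" using sym by (metis transpose_matrix_vector)
  moreover have "matrix_inv A *v (A *v w) = w"
    by (simp add: matrix_vector_mul_assoc matrix_inv_inverse[OF inv])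
  ultimately have "R = matrix_inv A *v (w v* A - u)"
    by (simp add: R_def matrix_vector_mult_diff_distrib)
  also have "w v* A - u = w v* (A - B) - e"
    using e by (simp add: vec_eq_iff vector_matrix_mult_def algebra_simps sum_subtractf)
  finally have "norm R \<le> norm (w v* (A - B) - e) * K" using K by simp
  also have "\<dots> \<le> (norm w * \<delta> + norm e) * K"
  proof -
    have "norm (w v* (A - B)) \<le> norm w * \<delta>"
      using norm_vector_matrix_mult_le[of w "A - B"] \<delta>(1) mult_left_mono[OF \<delta>(1), of "norm w"]
      by (simp add: norm_minus_commute)
    then show ?thesis
      using norm_triangle_ineq4[of "w v* (A - B)" e] \<open>K > 0\<close> by (intro mult_right_mono) auto
  qed
  also have "\<dots> \<le> ((norm R + \<rho> * K) * \<delta> + norm e) * K"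
  proof -
    have "norm w \<le> norm R + norm (matrix_inv A *v u)"
      using norm_triangle_ineq[of R "matrix_inv A *v u"] by (simp add: R_def)
    also have "norm (matrix_inv A *v u) \<le> \<rho> * K"
      using K[of u] mult_right_mono[OF u, of K] \<open>K > 0\<close> by linarith
    finally show ?thesis
      using \<open>0 \<le> \<delta>\<close> \<open>K > 0\<close> by (intro mult_right_mono add_right_mono) auto
  qed
  also have "\<dots> = norm R * (K * \<delta>) + K * (\<delta> * (\<rho> * K) + norm e)" by (simp add: algebra_simps)
  also have "\<dots> \<le> norm R * (1 / 2) + K * (\<delta> * (\<rho> * K) + norm e)"
    using \<delta>(2) by (intro add_right_mono mult_left_mono) auto
  finally show ?thesis unfolding R_def by (simp add: algebra_simps)
qed

text \<open>The remainder is controlled through the invertibility of \<open>A\<close>, so that tightness of the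
  rescaled estimator \<open>W\<close> need not be known in advance.\<close>

theorem estimating_equation_linearization:
  fixes U W :: "nat \<Rightarrow> 'a \<Rightarrow> real^'p" and A :: "real^'p^'p"
  assumes M: "prob_space M" and W [measurable]: "\<And>j. W j \<in> borel_measurable M"
    and U [measurable]: "\<And>j. U j \<in> borel_measurable M" and tight: "tight_seq M U"
    and sym: "transpose A = A" and inv: "invertible A"
    and B: "conv_prob M B A" and e: "conv_prob M e 0"
    and eq: "\<And>j \<omega>. \<omega> \<in> space M \<Longrightarrow> U j \<omega> - W j \<omega> v* B j \<omega> = e j \<omega>"
  shows "conv_prob M (\<lambda>j \<omega>. W j \<omega> - matrix_inv A *v U j \<omega>) 0"
proof -
  interpret prob_space M by fact
  have bl: "bounded_linear ((*v) (matrix_inv A))" by (rule matrix_vector_mul_bounded_linear)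
  have [measurable]: "(*v) (matrix_inv A) \<in> borel_measurable borel"
    by (rule borel_measurable_continuous_onI[OF linear_continuous_on[OF bl]])
  have [measurable]: "B j \<in> borel_measurable M" "e j \<in> borel_measurable M" for j
    using B e by (auto simp: conv_prob_def)
  obtain K where K: "K > 0" "\<And>x. norm (matrix_inv A *v x) \<le> norm x * K"
    using bounded_linear.pos_bounded[OF bl] by blast
  define R where "R j \<omega> = W j \<omega> - matrix_inv A *v U j \<omega>" for j \<omega>
  have [measurable]: "R j \<in> borel_measurable M" for j unfolding R_def by measurable
  have "(\<lambda>j. prob {\<omega>\<in>space M. norm (R j \<omega>) > \<epsilon>}) \<longlonglongrightarrow> 0" if "\<epsilon> > 0" for \<epsilon>
  proof (rule tendstoI)
    fix \<eta> :: real assume "\<eta> > 0"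
    then obtain \<rho> where \<rho>: "\<rho> > 0" "\<forall>\<^sub>F j in sequentially. prob {\<omega>\<in>space M. norm (U j \<omega>) > \<rho>} < \<eta> / 3"
      using tight unfolding tight_seq_def by (meson divide_pos_pos zero_less_numeral)
    \<comment> \<open>The first entry permits the absorption. The second limits the contribution of
      the matrix error to \<epsilon>/2; \<kappa> does the same for the contribution of
      \<open>e\<close>.\<close>
    define \<delta> where "\<delta> = min (1 / (2 * K)) (\<epsilon> / (4 * K * (\<rho> * K)))"
    define \<kappa> where "\<kappa> = \<epsilon> / (4 * K)"
    have pos: "\<delta> > 0" "\<kappa> > 0" using K(1) \<rho>(1) \<open>\<epsilon> > 0\<close> by (auto simp: \<delta>_def \<kappa>_def)
    have \<delta>: "K * \<delta> \<le> 1 / 2"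
      using K(1) mult_left_mono[of \<delta> "1 / (2 * K)" K] by (simp add: \<delta>_def)
    have \<delta>': "4 * K * (\<rho> * K) * \<delta> \<le> \<epsilon>"
      using K(1) \<rho>(1) mult_left_mono[of \<delta> "\<epsilon> / (4 * K * (\<rho> * K))" "4 * K * (\<rho> * K)"]
      by (simp add: \<delta>_def)
    have \<kappa>: "4 * K * \<kappa> = \<epsilon>" using K(1) by (simp add: \<kappa>_def)
    let ?U = "\<lambda>j. {\<omega>\<in>space M. norm (U j \<omega>) > \<rho>}"
      and ?B = "\<lambda>j. {\<omega>\<in>space M. dist (B j \<omega>) A > \<delta>}"
      and ?e = "\<lambda>j. {\<omega>\<in>space M. dist (e j \<omega>) 0 > \<kappa>}"
    have sub: "{\<omega>\<in>space M. norm (R j \<omega>) > \<epsilon>} \<subseteq> ?U j \<union> (?B j \<union> ?e j)" for j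
    proof (rule subsetI, rule ccontr)
      fix \<omega> assume \<omega>: "\<omega> \<in> {\<omega>\<in>space M. norm (R j \<omega>) > \<epsilon>}" "\<omega> \<notin> ?U j \<union> (?B j \<union> ?e j)"
      then have "norm (R j \<omega>) \<le> 2 * K * (\<delta> * (\<rho> * K) + norm (e j \<omega>))"
        unfolding R_def using \<delta>
        by (intro linearization_error_bound[OF sym inv K(2,1) _ _ _ eq]) (auto simp: dist_norm not_less)
      also have "\<dots> \<le> 2 * K * (\<delta> * (\<rho> * K) + \<kappa>)"
        using \<omega> K(1) by (intro mult_left_mono add_left_mono) auto
      also have "\<dots> = (4 * K * (\<rho> * K) * \<delta> + 4 * K * \<kappa>) / 2" by (simp add: algebra_simps)
      also have "\<dots> \<le> \<epsilon>" using \<delta>' \<kappa> by simp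
      finally show False using \<omega> by simp
    qed
    have "(\<lambda>j. prob (?B j)) \<longlonglongrightarrow> 0" "(\<lambda>j. prob (?e j)) \<longlonglongrightarrow> 0"
      using B e pos by (auto simp: conv_prob_def)
    then have "\<forall>\<^sub>F j in sequentially. prob (?B j) < \<eta> / 3" "\<forall>\<^sub>F j in sequentially. prob (?e j) < \<eta> / 3"
      using \<open>\<eta> > 0\<close> by (auto elim!: order_tendstoD(2) simp del: less_divide_eq_numeral1 dist_0_norm)
    with \<rho>(2) show "\<forall>\<^sub>F j in sequentially. dist (prob {\<omega>\<in>space M. norm (R j \<omega>) > \<epsilon>}) 0 < \<eta>"
    proof eventually_elim
      case (elim j)
      have "prob {\<omega>\<in>space M. norm (R j \<omega>) > \<epsilon>} \<le> prob (?U j \<union> (?B j \<union> ?e j))"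
        by (rule finite_measure_mono[OF sub]) measurable
      also have "\<dots> \<le> prob (?U j) + prob (?B j \<union> ?e j)"
        by (rule measure_Un_le) measurable
      also have "prob (?B j \<union> ?e j) \<le> prob (?B j) + prob (?e j)"
        by (rule measure_Un_le) measurable
      finally show ?case using elim by simp
    qed
  qed
  then show ?thesis unfolding conv_prob_def R_def[symmetric] by simp
qed

section \<open>The association model\<close>

lemma bounded_linear_theta_of: "bounded_linear (theta_of :: real^('s::finite + 'k::finite) \<Rightarrow> real^'s)"
  by (rule linear_conv_bounded_linear[THEN iffD1])
    (auto simp: theta_of_def linear_iff vec_eq_iff)

lemma bounded_linear_gam:
  "bounded_linear (\<lambda>lam :: real^('s::finite + 'k::finite). gam lam c)"
  by (rule linear_conv_bounded_linear[THEN iffD1]) (cases c; auto simp: gam_def linear_iff)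

lemma sum_UNIV_sum:
  "(\<Sum>p\<in>UNIV. g p) = (\<Sum>i\<in>UNIV. g (Inl i)) + (\<Sum>j\<in>UNIV. g (Inr j))"
  for g :: "'s::finite + 'k::finite \<Rightarrow> real"
  by (subst UNIV_Plus_UNIV[symmetric], subst sum.Plus) simp_all

lemma inner_mk_lam_0: "mk_lam t (\<lambda>_. 0) \<bullet> x = t \<bullet> theta_of x"
  by (simp add: inner_vec_def sum_UNIV_sum mk_lam_def theta_of_def)

lemma theta_of_mk_lam: "theta_of (mk_lam th g) = th"
  by (simp add: theta_of_def mk_lam_def vec_eq_iff)

lemma p_star_pos: "p_star psi y c x lam > 0"
  unfolding p_star_def by (intro divide_pos_pos sum_pos) auto

lemma sum_p_star: "(\<Sum>c\<in>UNIV. p_star psi y c x lam) = 1"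
proof -
  have "(\<Sum>l\<in>UNIV. exp (gam lam l + psi (theta_of lam) x (y l))) > 0"
    by (intro sum_pos) auto
  then show ?thesis by (simp add: p_star_def sum_divide_distrib[symmetric])
qed

lemma ln_p_star:
  "ln (p_star psi y c x lam) = gam lam c + psi (theta_of lam) x (y c) -
    ln (\<Sum>l\<in>UNIV. exp (gam lam l + psi (theta_of lam) x (y l)))"
proof -
  have "(\<Sum>l\<in>UNIV. exp (gam lam l + psi (theta_of lam) x (y l))) > 0"
    by (intro sum_pos) auto
  then show ?thesis by (simp add: p_star_def ln_div)
qed

lemma Ck_ln_p_star:
  fixes psi :: "real^'s::finite \<Rightarrow> 'x \<Rightarrow> 'y \<Rightarrow> real" and y :: "'k::finite option \<Rightarrow> 'y"
  assumes "\<And>c. Ck k (\<lambda>th. psi th x (y c))"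
  shows "Ck k (\<lambda>lam. ln (p_star psi y c x lam))"
proof -
  have "Ck k (\<lambda>lam :: real^('s + 'k). gam lam c + psi (theta_of lam) x (y c))" for c
    by (intro Ck_add Ck_linear bounded_linear_gam
        Ck_linear_compose[OF bounded_linear_theta_of, of k "\<lambda>th. psi th x (y c)"] assms)
  then show ?thesis
    unfolding ln_p_star by (intro Ck_diff Ck_ln Ck_sum Ck_exp sum_pos) auto
qed

text \<open>Along the axis of \<gamma>_j only the predictor of class \<open>Some j\<close> moves, at
  unit rate, because \<open>psi\<close> depends on \<theta> alone. The subtracted term comes from
  the normalizing sum and is the same for every class c.\<close>

lemma grad_ln_p_star_Inr:
  fixes psi :: "real^'s::finite \<Rightarrow> 'x \<Rightarrow> 'y \<Rightarrow> real" and y :: "'k::finite option \<Rightarrow> 'y"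
  assumes D: "\<And>c v. (\<lambda>th. psi th x (y c)) differentiable (at v)"
  shows "grad (\<lambda>lam. ln (p_star psi y c x lam)) lam $ Inr j =
    (if c = Some j then 1 else 0) - p_star psi y (Some j) x lam"
proof -
  define a where "a c lam = gam lam c + psi (theta_of lam) x (y c)" for c and lam :: "real^('s + 'k)"
  define a' where "a' c h = gam h c + theta_of h \<bullet> grad (\<lambda>th. psi th x (y c)) (theta_of lam)"
    for c and h :: "real^('s + 'k)"
  define S where "S = (\<Sum>l\<in>UNIV. exp (a l lam))"
  have S: "S > 0" unfolding S_def by (intro sum_pos) auto
  have a: "(a c has_derivative a' c) (at lam)" for c
    unfolding a_def[abs_def] a'_def[abs_def]
    by (intro has_derivative_add bounded_linear_imp_has_derivative bounded_linear_gam
        has_derivative_compose[OF bounded_linear_imp_has_derivative[OF bounded_linear_theta_of]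
          has_derivative_grad[OF D]])
  have "((\<lambda>lam. ln (\<Sum>l\<in>UNIV. exp (a l lam))) has_derivative
      (\<lambda>h. (\<Sum>l\<in>UNIV. exp (a l lam) * a' l h) / S)) (at lam)"
    using a S by (auto intro!: derivative_eq_intros simp: S_def divide_inverse mult.commute)
  then have "((\<lambda>lam. ln (p_star psi y c x lam)) has_derivative
      (\<lambda>h. a' c h - (\<Sum>l\<in>UNIV. exp (a l lam) * a' l h) / S)) (at lam)"
    unfolding ln_p_star a_def[symmetric] by (intro has_derivative_diff a)
  then have "grad (\<lambda>lam. ln (p_star psi y c x lam)) lam $ Inr j =
      a' c (axis (Inr j) 1) - (\<Sum>l\<in>UNIV. exp (a l lam) * a' l (axis (Inr j) 1)) / S"
    by (rule grad_nth_eqI)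
  moreover have "a' c (axis (Inr j) 1) = (if c = Some j then 1 else 0)" for c
  proof -
    have "theta_of (axis (Inr j) 1 :: real^('s + 'k)) = 0"
      by (simp add: theta_of_def axis_def vec_eq_iff)
    then show ?thesis by (cases c) (auto simp: a'_def gam_def axis_def)
  qed
  moreover have "exp (a (Some j) lam) / S = p_star psi y (Some j) x lam"
    by (simp add: a_def S_def p_star_def)
  ultimately show ?thesis by (simp add: if_distrib cong: if_cong)
qed

lemma p_star_measurable:
  assumes "\<And>th c. (\<lambda>x. psi th x (y c)) \<in> borel_measurable N"
  shows "(\<lambda>x. p_star psi y c x lam) \<in> borel_measurable N"
  unfolding p_star_def using assms by measurable

lemma borel_measurable_vecI:
  fixes F :: "'z \<Rightarrow> real^'p"
  assumes "\<And>i. (\<lambda>x. F x $ i) \<in> borel_measurable N"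
  shows "F \<in> borel_measurable N"
proof (subst borel_measurable_euclidean_space, safe)
  fix b :: "real^'p" assume "b \<in> Basis"
  then obtain i where "b = axis i 1" by (auto simp: Basis_vec_def)
  then show "(\<lambda>x. F x \<bullet> b) \<in> borel_measurable N"
    using assms by (simp add: inner_axis)
qed

section \<open>Identities at the true parameter\<close>

locale association_model =
  fixes nuX :: "'x measure" and y :: "'k::finite option \<Rightarrow> 'y"
    and psi :: "real^'s::finite \<Rightarrow> 'x \<Rightarrow> 'y \<Rightarrow> real"
    and theta0 :: "real^'s"
    and f :: "'k option \<Rightarrow> 'x \<Rightarrow> real" and beta :: "'x \<Rightarrow> real"
    and eps r :: "'k option \<Rightarrow> real"
  assumes psi_meas [measurable]: "\<And>th c. (\<lambda>x. psi th x (y c)) \<in> borel_measurable nuX"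
    and psi_C3: "\<And>x c. x \<in> space nuX \<Longrightarrow> Ck 3 (\<lambda>th. psi th x (y c))"
    and f_meas [measurable]: "\<And>c. f c \<in> borel_measurable nuX"
    and f_pos: "\<And>c x. x \<in> space nuX \<Longrightarrow> f c x > 0"
    and f_prob: "\<And>c. (\<integral>\<^sup>+ x. ennreal (f c x) \<partial>nuX) = 1"
    and f_form: "\<And>c x. x \<in> space nuX \<Longrightarrow> ln (f c x) = beta x + psi theta0 x (y c) - eps c"
    and r_pos: "\<And>c. r c > 0"
begin

definition P :: "'k option \<Rightarrow> 'x measure" where
  "P c = density nuX (\<lambda>x. ennreal (f c x))"

definition lam0 :: "real^('s + 'k)" where
  "lam0 = mk_lam theta0 (\<lambda>j. ln (r (Some j)) - eps (Some j) - ln (r None) + eps None)"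

definition score :: "'k option \<Rightarrow> 'x \<Rightarrow> real^('s + 'k)" where
  "score c x = grad (\<lambda>l. ln (p_star psi y c x l)) lam0"

definition hessian :: "'k option \<Rightarrow> 'x \<Rightarrow> real^('s + 'k)^('s + 'k)" where
  "hessian c x = hess (\<lambda>l. ln (p_star psi y c x l)) lam0"

lemma sets_P [measurable_cong, simp]: "sets (P c) = sets nuX"
  by (simp add: P_def)

lemma prob_space_P: "prob_space (P c)"
  by (intro prob_spaceI) (simp add: P_def emeasure_density f_prob cong: nn_integral_cong)

lemma psi_C2: "x \<in> space nuX \<Longrightarrow> Ck 2 (\<lambda>th. psi th x (y c))"
  using psi_C3 unfolding numeral_2_eq_2 numeral_3_eq_3 by (rule Ck_Suc_imp_Ck)

lemma p_star_measurable_nuX [measurable]: "(\<lambda>x. p_star psi y c x lam) \<in> borel_measurable nuX"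
  by (rule p_star_measurable) (rule psi_meas)

lemma Ck_log_p_star: "x \<in> space nuX \<Longrightarrow> Ck 2 (\<lambda>l. ln (p_star psi y c x l))"
  by (rule Ck_ln_p_star) (rule psi_C2)

lemma grad_component_measurable:
  "(\<lambda>x. grad (\<lambda>l. ln (p_star psi y c x l)) v $ i) \<in> borel_measurable nuX"
  unfolding grad_def vec_lambda_beta
  by (rule frechet_derivative_measurable[of "\<lambda>v x. ln (p_star psi y c x v)"])
    (measurable, rule Ck_2_grad(1)[OF Ck_log_p_star])

lemma score_measurable [measurable]: "score c \<in> borel_measurable nuX"
  by (rule borel_measurable_vecI) (simp add: score_def grad_component_measurable)

lemma hessian_nth_measurable [measurable]: "(\<lambda>x. hessian c x $ i $ j) \<in> borel_measurable nuX"
  unfolding hessian_def hess_def vec_lambda_beta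
  by (rule frechet_derivative_measurable[of "\<lambda>v x. grad (\<lambda>l. ln (p_star psi y c x l)) v $ j"])
    (rule grad_component_measurable, rule Ck_2_grad(2)[OF Ck_log_p_star])

lemma hessian_measurable [measurable]: "hessian c \<in> borel_measurable nuX"
proof (subst borel_measurable_euclidean_space, safe)
  fix b :: "real^('s + 'k)^('s + 'k)" assume "b \<in> Basis"
  then obtain i j where "b = axis i (axis j 1)" by (auto simp: Basis_vec_def)
  then show "(\<lambda>x. hessian c x \<bullet> b) \<in> borel_measurable nuX"
    by (simp add: inner_axis hessian_nth_measurable)
qed

text \<open>The parameter \<open>lam0\<close> makes \<open>p_star\<close> the posterior class probability under the mixture
  \<open>\<Sum>\<^sub>c r c * f c\<close>.\<close>

lemma p_star_lam0:
  assumes x: "x \<in> space nuX"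
  shows "r c * f c x = (\<Sum>l\<in>UNIV. r l * f l x) * p_star psi y c x lam0"
proof -
  \<comment> \<open>The factor common to all classes: dividing \<open>r c * f c x\<close> by it
    leaves exactly the numerator of \<open>p_star\<close> at \<open>lam0\<close>, and
    \<open>C\<close> cancels in the quotient.\<close>
  define C where "C = exp (ln (r None) - eps None + beta x)"
  have rf: "r c * f c x = C * exp (gam lam0 c + psi theta0 x (y c))" for c
  proof -
    have "r c * f c x = exp (ln (r c) + ln (f c x))"
      using r_pos f_pos[OF x] by (simp add: exp_add)
    also have "ln (r c) + ln (f c x) = (ln (r None) - eps None + beta x) + (gam lam0 c + psi theta0 x (y c))"
      by (cases c) (simp_all add: f_form[OF x] gam_def lam0_def mk_lam_def)
    finally show ?thesis by (simp add: C_def exp_add)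
  qed
  have th: "theta_of lam0 = theta0" by (simp add: lam0_def theta_of_mk_lam)
  have pos: "(\<Sum>l\<in>UNIV. exp (gam lam0 l + psi theta0 x (y l))) > 0" by (intro sum_pos) auto
  have "(\<Sum>l\<in>UNIV. r l * f l x) = C * (\<Sum>l\<in>UNIV. exp (gam lam0 l + psi theta0 x (y l)))"
    unfolding rf by (simp add: sum_distrib_left)
  then show ?thesis unfolding rf[of c] p_star_def th using pos by simp
qed

text \<open>Turns pointwise identities into moment identities: \<open>r c * f c\<close> is the
  mixture density times \<open>p_star\<close>, so the weighted sum of class expectations is a single
  integral against \<open>nuX\<close> whose integrand contains the \<open>p_star\<close>-weighted
  sum as a factor.\<close>

lemma mixture_integral_zero:
  assumes G: "\<And>c. integrable (P c) (G c)" and Gm [measurable]: "\<And>c. G c \<in> borel_measurable nuX"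
    and zero: "\<And>x. x \<in> space nuX \<Longrightarrow> (\<Sum>c\<in>UNIV. p_star psi y c x lam0 * G c x) = (0 :: real)"
  shows "(\<Sum>c\<in>UNIV. r c * (\<integral>x. G c x \<partial>P c)) = 0"
proof -
  have nn: "AE x in nuX. 0 \<le> f c x" for c using f_pos by (auto intro!: AE_I2 less_imp_le)
  have int: "integrable nuX (\<lambda>x. f c x * G c x)" for c
    using G[of c] nn by (simp add: P_def integrable_density)
  have "(\<Sum>c\<in>UNIV. r c * (\<integral>x. G c x \<partial>P c)) = (\<Sum>c\<in>UNIV. r c * (\<integral>x. f c x * G c x \<partial>nuX))"
    using nn by (simp add: P_def integral_density)
  also have "\<dots> = (\<integral>x. (\<Sum>c\<in>UNIV. r c * (f c x * G c x)) \<partial>nuX)"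
    using int by (simp add: Bochner_Integration.integral_sum)
  also have "\<dots> = (\<integral>x. 0 \<partial>nuX)"
  proof (rule Bochner_Integration.integral_cong[OF refl])
    fix x assume x: "x \<in> space nuX"
    have "(\<Sum>c\<in>UNIV. r c * (f c x * G c x)) =
        (\<Sum>l\<in>UNIV. r l * f l x) * (\<Sum>c\<in>UNIV. p_star psi y c x lam0 * G c x)"
      unfolding sum_distrib_left mult.assoc[symmetric] p_star_lam0[OF x, symmetric] ..
    then show "(\<Sum>c\<in>UNIV. r c * (f c x * G c x)) = 0" by (simp add: zero[OF x])
  qed
  finally show ?thesis by simp
qed

lemma pointwise_score:
  assumes x: "x \<in> space nuX"
  shows "(\<Sum>c\<in>UNIV. p_star psi y c x lam0 * score c x $ i) = 0"
  using score_identity[where L = "\<lambda>c l. ln (p_star psi y c x l)", OF Ck_2_grad(1)[OF Ck_log_p_star[OF x]], where v=lam0 and j=i]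
  by (simp add: p_star_pos sum_p_star score_def)

lemma pointwise_information:
  assumes x: "x \<in> space nuX"
  shows "(\<Sum>c\<in>UNIV. p_star psi y c x lam0 * (hessian c x $ i $ j + score c x $ i * score c x $ j)) = 0"
  using information_identity[where L = "\<lambda>c l. ln (p_star psi y c x l)", OF Ck_log_p_star[OF x], where v=lam0 and i=i and j=j]
  by (simp add: p_star_pos sum_p_star score_def hessian_def)

lemma score_Inr:
  assumes x: "x \<in> space nuX"
  shows "score c x $ Inr j = (if c = Some j then 1 else 0) - p_star psi y (Some j) x lam0"
  unfolding score_def by (rule grad_ln_p_star_Inr) (rule Ck_2_grad(1)[OF psi_C2[OF x]])

end

section \<open>Information matrix, score covariance and the \<theta>-block\<close>

locale association_model_moments =
  association_model nuX y psi theta0 f beta eps r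
  for nuX :: "'x measure" and y :: "'k::finite option \<Rightarrow> 'y"
    and psi :: "real^'s::finite \<Rightarrow> 'x \<Rightarrow> 'y \<Rightarrow> real" and theta0 f beta eps r +
  assumes score_sq: "\<And>c. integrable (P c) (\<lambda>x. (norm (score c x))\<^sup>2)"
    and hessian_integrable_norm: "\<And>c. integrable (P c) (\<lambda>x. norm (hessian c x))"
begin

abbreviation I where "I \<equiv> Ibar psi y r P lam0"
abbreviation \<Sigma> where "\<Sigma> \<equiv> Sigmabar psi y r P lam0"

definition mean_score :: "'k option \<Rightarrow> real^('s + 'k)" where
  "mean_score c = (\<chi> i. \<integral>x. score c x $ i \<partial>P c)"

lemma score_mult_integrable: "integrable (P c) (\<lambda>x. score c x $ i * score c x $ j)"
  using square_integrable_component[OF _ score_sq]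
  by (intro integrable_square_mult) auto

lemma score_integrable: "integrable (P c) (\<lambda>x. score c x $ i)"
proof -
  interpret prob_space "P c" by (rule prob_space_P)
  show ?thesis
    by (rule square_integrable_imp_integrable[OF _ square_integrable_component[OF _ score_sq]]) auto
qed

lemma hessian_integrable: "integrable (P c) (\<lambda>x. hessian c x $ i $ j)"
    and integral_hessian: "(\<integral>x. hessian c x \<partial>P c) $ i $ j = (\<integral>x. hessian c x $ i $ j \<partial>P c)"
proof -
  have "integrable (P c) (hessian c)"
    using hessian_integrable_norm by (rule integrable_norm_cancel) auto
  moreover have bl: "bounded_linear (\<lambda>A :: real^('s + 'k)^('s + 'k). A $ i $ j)"
    by (intro bounded_linear_compose[OF bounded_linear_vec_nth] bounded_linear_vec_nth)
  ultimately show "integrable (P c) (\<lambda>x. hessian c x $ i $ j)"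
    "(\<integral>x. hessian c x \<partial>P c) $ i $ j = (\<integral>x. hessian c x $ i $ j \<partial>P c)"
    using integrable_bounded_linear[OF bl, of "P c" "hessian c"]
      integral_bounded_linear[OF bl, of "P c" "hessian c"] by auto
qed

lemma mean_score_centered: "(\<Sum>c\<in>UNIV. r c * (\<integral>x. score c x $ i \<partial>P c)) = 0"
  by (rule mixture_integral_zero[OF score_integrable]) (auto intro: pointwise_score)

text \<open>The information identity for the conditional class probabilities, averaged over the
  mixture. It produces uncentred second moments, since the class means are not removed.\<close>

lemma Ibar_nth: "I $ i $ j = (\<Sum>c\<in>UNIV. r c * (\<integral>x. score c x $ i * score c x $ j \<partial>P c))"
proof -
  have "(\<Sum>c\<in>UNIV. r c * (\<integral>x. hessian c x $ i $ j + score c x $ i * score c x $ j \<partial>P c)) = 0"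
    by (rule mixture_integral_zero)
      (auto intro: pointwise_information hessian_integrable score_mult_integrable)
  moreover have "I $ i $ j = (\<Sum>c\<in>UNIV. r c * - (\<integral>x. hessian c x $ i $ j \<partial>P c))"
    by (simp add: Ibar_def hessian_def[symmetric] sum_component integral_hessian)
  ultimately show ?thesis
    by (simp add: hessian_integrable score_mult_integrable distrib_left sum.distrib sum_negf)
qed

text \<open>The \<gamma>_j-score is an indicator of class \<open>Some j\<close> minus a probability
  that does not depend on c. That probability factors out of the sum over the classes, so its
  contribution vanishes by the score identity; the indicator leaves one class mean.\<close>

lemma Ibar_Inr: "I $ i $ Inr j = r (Some j) * mean_score (Some j) $ i"
proof -
  have pint: "integrable (P c) (\<lambda>x. p_star psi y (Some j) x lam0 * score c x $ i)" for c
  proof (rule Bochner_Integration.integrable_bound[OF score_integrable[of c i]])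
    show "(\<lambda>x. p_star psi y (Some j) x lam0 * score c x $ i) \<in> borel_measurable (P c)"
      by measurable
    have "p_star psi y (Some j) x lam0 \<le> 1" for x
      using member_le_sum[of "Some j" UNIV "\<lambda>c. p_star psi y c x lam0"]
      by (simp add: sum_p_star p_star_pos less_imp_le)
    then show "AE x in P c. norm (p_star psi y (Some j) x lam0 * score c x $ i) \<le> norm (score c x $ i)"
      using p_star_pos[of psi y "Some j" _ lam0, THEN less_imp_le]
      by (auto simp: abs_mult intro!: AE_I2 mult_left_le_one_le)
  qed
  have zero: "(\<Sum>c\<in>UNIV. r c * (\<integral>x. p_star psi y (Some j) x lam0 * score c x $ i \<partial>P c)) = 0"
  proof (rule mixture_integral_zero[OF pint])
    show "(\<lambda>x. p_star psi y (Some j) x lam0 * score c x $ i) \<in> borel_measurable nuX" for c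
      by measurable
    show "(\<Sum>c\<in>UNIV. p_star psi y c x lam0 * (p_star psi y (Some j) x lam0 * score c x $ i)) = 0"
      if "x \<in> space nuX" for x
    proof -
      have "(\<Sum>c\<in>UNIV. p_star psi y c x lam0 * (p_star psi y (Some j) x lam0 * score c x $ i)) =
          p_star psi y (Some j) x lam0 * (\<Sum>c\<in>UNIV. p_star psi y c x lam0 * score c x $ i)"
        by (simp add: sum_distrib_left mult_ac)
      then show ?thesis by (simp add: pointwise_score[OF that])
    qed
  qed
  have "(\<integral>x. score c x $ i * score c x $ Inr j \<partial>P c) =
      (if c = Some j then 1 else 0) * mean_score c $ i -
      (\<integral>x. p_star psi y (Some j) x lam0 * score c x $ i \<partial>P c)" for c
  proof -
    have "(\<integral>x. score c x $ i * score c x $ Inr j \<partial>P c) =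
        (\<integral>x. (if c = Some j then 1 else 0) * score c x $ i - p_star psi y (Some j) x lam0 * score c x $ i \<partial>P c)"
      by (rule Bochner_Integration.integral_cong[OF refl])
        (simp add: P_def score_Inr algebra_simps)
    also have "\<dots> = (if c = Some j then 1 else 0) * (\<integral>x. score c x $ i \<partial>P c) -
        (\<integral>x. p_star psi y (Some j) x lam0 * score c x $ i \<partial>P c)"
      using pint score_integrable by simp
    finally show ?thesis by (simp add: mean_score_def)
  qed
  then have "I $ i $ Inr j = (\<Sum>c\<in>UNIV. r c * ((if c = Some j then 1 else 0) * mean_score c $ i))"
    using zero by (simp add: Ibar_nth right_diff_distrib sum_subtractf)
  also have "\<dots> = (\<Sum>c\<in>UNIV. if c = Some j then r c * mean_score c $ i else 0)"
    by (rule sum.cong) auto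
  finally show ?thesis by simp
qed

lemma Sigmabar_nth: "\<Sigma> $ i $ j = I $ i $ j - (\<Sum>c\<in>UNIV. r c * (mean_score c $ i * mean_score c $ j))"
proof -
  have "covmat (P c) (score c) $ i $ j =
      (\<integral>x. score c x $ i * score c x $ j \<partial>P c) - mean_score c $ i * mean_score c $ j" for c
  proof -
    interpret prob_space "P c" by (rule prob_space_P)
    have "covmat (P c) (score c) $ i $ j =
        (\<integral>x. score c x $ i * score c x $ j - mean_score c $ j * score c x $ i
          - mean_score c $ i * score c x $ j + mean_score c $ i * mean_score c $ j \<partial>P c)"
      by (simp add: covmat_def mean_score_def algebra_simps)
    also have "\<dots> = (\<integral>x. score c x $ i * score c x $ j \<partial>P c) - mean_score c $ i * mean_score c $ j"
      using score_mult_integrable score_integrable by (simp add: prob_space mean_score_def)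
    finally show ?thesis .
  qed
  then show ?thesis
    by (simp add: Sigmabar_def score_def[symmetric] sum_component Ibar_nth right_diff_distrib sum_subtractf)
qed

lemma Sigmabar_quadratic_form:
  "t \<bullet> (\<Sigma> *v t) = t \<bullet> (I *v t) - (\<Sum>c\<in>UNIV. r c * (mean_score c \<bullet> t)\<^sup>2)"
proof -
  have "\<Sigma> *v t = I *v t - (\<Sum>c\<in>UNIV. (r c * (mean_score c \<bullet> t)) *\<^sub>R mean_score c)"
  proof -
    have "(\<Sum>j\<in>UNIV. (\<Sum>c\<in>UNIV. r c * (mean_score c $ i * mean_score c $ j)) * t $ j) =
        (\<Sum>c\<in>UNIV. r c * (\<Sum>j\<in>UNIV. mean_score c $ j * t $ j) * mean_score c $ i)" for i
      by (simp add: sum_distrib_right sum_distrib_left algebra_simps) (rule sum.swap)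
    then show ?thesis
      by (simp add: vec_eq_iff matrix_vector_mult_def Sigmabar_nth left_diff_distrib sum_subtractf
          inner_vec_def sum_component)
  qed
  then have "t \<bullet> (\<Sigma> *v t) = t \<bullet> (I *v t - (\<Sum>c\<in>UNIV. (r c * (mean_score c \<bullet> t)) *\<^sub>R mean_score c))"
    by (rule arg_cong)
  then show ?thesis
    by (simp add: inner_diff_right inner_sum_right power2_eq_square inner_commute[of t] mult.assoc)
qed

text \<open>For \<open>Some j\<close>, symmetry identifies the \<gamma>_j-component of
  \<open>I *v w\<close> with \<open>r (Some j)\<close> times the inner product in question. The
  baseline class has no component of its own and follows from the vanishing weighted sum of mean
  scores.\<close>

lemma mean_score_orthogonal:
  assumes sym: "transpose I = I" and w: "\<And>j. (I *v w) $ Inr j = 0"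
  shows "mean_score c \<bullet> w = 0"
proof -
  have S: "mean_score (Some j) \<bullet> w = 0" for j
  proof -
    have "I $ i $ Inr j = I $ Inr j $ i" for i
      using arg_cong[OF sym, of "\<lambda>A. A $ Inr j $ i"] by (simp add: transpose_def)
    then have "r (Some j) * (mean_score (Some j) \<bullet> w) = (I *v w) $ Inr j"
      by (simp add: inner_vec_def matrix_vector_mult_def sum_distrib_left mult.assoc[symmetric] Ibar_Inr[symmetric])
    with w r_pos[of "Some j"] show ?thesis by simp
  qed
  show ?thesis
  proof (cases c)
    case None
    have "(\<Sum>c\<in>UNIV. r c * (mean_score c \<bullet> w)) = (\<Sum>i\<in>UNIV. w $ i * (\<Sum>c\<in>UNIV. r c * (\<integral>x. score c x $ i \<partial>P c)))"
      unfolding inner_vec_def mean_score_def sum_distrib_left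
      by (subst sum.swap) (simp add: algebra_simps)
    also have "\<dots> = 0" by (simp add: mean_score_centered)
    finally show ?thesis
      using None S r_pos[of None] by (simp add: UNIV_option_conv sum.reindex)
  qed (simp add: S)
qed

lemma Sigmabar_transpose: "transpose \<Sigma> = \<Sigma>"
  by (simp add: Sigmabar_def transpose_def vec_eq_iff sum_component covmat_def mult.commute)

lemma Sigmabar_psd: "t \<bullet> (\<Sigma> *v t) \<ge> 0"
proof -
  have "t \<bullet> (covmat (P c) (score c) *v t) \<ge> 0" for c
  proof -
    interpret prob_space "P c" by (rule prob_space_P)
    show ?thesis by (subst covmat_quadratic_form(1)[OF _ score_sq]) auto
  qed
  then show ?thesis
    by (simp add: Sigmabar_def score_def[symmetric] matrix_vector_mult_sum_left inner_sum_right
        scaleR_matrix_vector_assoc[symmetric] sum_nonneg r_pos less_imp_le)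
qed

text \<open>For the \<open>\<theta>\<close>-block, \<open>w = I\<^sup>-\<^sup>1 (t, 0)\<close> satisfies \<open>I w = (t, 0)\<close>, hence is orthogonal to all
  \<open>mean_score c\<close>, and \<open>\<Sigma>\<close> may be replaced by \<open>I\<close> in \<open>w \<bullet> \<Sigma> w\<close>.\<close>

lemma sandwich_theta_block:
  assumes pd: "pos_def I"
  defines "C \<equiv> matrix_inv I"
  shows "t \<bullet> ((\<chi> i i'. C $ Inl i $ Inl i') *v t) =
    mk_lam t (\<lambda>_. 0) \<bullet> ((C ** \<Sigma> ** C) *v mk_lam t (\<lambda>_. 0))"
proof -
  have sym: "transpose I = I" using pd by (simp add: pos_def_def)
  note inv = pos_def_invertible[OF pd]
  have symC: "transpose C = C" unfolding C_def by (rule transpose_matrix_inv[OF sym inv])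
  define u :: "real^('s + 'k)" where "u = mk_lam t (\<lambda>_. 0)"
  define w where "w = C *v u"
  have Iw: "I *v w = u"
    by (simp add: w_def C_def matrix_vector_mul_assoc matrix_inv_inverse[OF inv])
  then have "(I *v w) $ Inr j = 0" for j by (simp add: u_def mk_lam_def)
  then have "mean_score c \<bullet> w = 0" for c by (rule mean_score_orthogonal[OF sym])
  then have "w \<bullet> (\<Sigma> *v w) = w \<bullet> u" by (simp add: Sigmabar_quadratic_form Iw)
  moreover have "u \<bullet> ((C ** \<Sigma> ** C) *v u) = w \<bullet> (\<Sigma> *v w)"
  proof -
    have "u \<bullet> ((C ** \<Sigma> ** C) *v u) = u \<bullet> (C *v (\<Sigma> *v w))"
      by (simp add: w_def matrix_vector_mul_assoc matrix_mul_assoc)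
    also have "\<dots> = (u v* C) \<bullet> (\<Sigma> *v w)" by (rule dot_lmul_matrix[symmetric])
    also have "u v* C = w" unfolding w_def using transpose_matrix_vector[of C u] symC by simp
    finally show ?thesis .
  qed
  moreover have "u \<bullet> (C *v u) = t \<bullet> ((\<chi> i i'. C $ Inl i $ Inl i') *v t)"
    by (simp add: u_def inner_mk_lam_0 inner_vec_def theta_of_def matrix_vector_mult_def
        sum_UNIV_sum mk_lam_def)
  ultimately show ?thesis by (simp add: u_def w_def inner_commute)
qed

end

section \<open>Asymptotic normality of the estimators\<close>

theorem theorem5:
  fixes M :: "'a measure"
    and nuX :: "'x measure" and MY :: "'y measure"
    and y :: "'k::finite option \<Rightarrow> 'y"
    and psi :: "real^'s::finite \<Rightarrow> 'x \<Rightarrow> 'y \<Rightarrow> real"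
    and theta0 :: "real^'s"
    and f :: "'k option \<Rightarrow> 'x \<Rightarrow> real"
    and beta :: "'x \<Rightarrow> real" and eps :: "'k option \<Rightarrow> real"
    and r :: "'k option \<Rightarrow> real"
    and X :: "'k option \<Rightarrow> nat \<Rightarrow> 'a \<Rightarrow> 'x"
    and N :: "nat \<Rightarrow> nat"
    and lamhat :: "nat \<Rightarrow> 'a \<Rightarrow> real^('s + 'k)"
  defines "P \<equiv> (\<lambda>c. density nuX (\<lambda>x. ennreal (f c x)))"
    and "lam0 \<equiv> mk_lam theta0
           (\<lambda>j. ln (r (Some j)) - eps (Some j) - ln (r None) + eps None)"
    and "J \<equiv> (\<lambda>n \<omega> lam. - hess (loglik psi y r X n \<omega>) lam)"
  assumes sigma_fin: "sigma_finite_measure nuX"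
    and y_space: "\<And>c. y c \<in> space MY"
    and y_distinct: "inj y"
    and psi_meas: "\<And>th c. (\<lambda>x. psi th x (y c)) \<in> borel_measurable nuX"
    and psi_0: "\<And>th x. x \<in> space nuX \<Longrightarrow> psi th x (y None) = 0"
    and psi_C3: "\<And>x c. x \<in> space nuX \<Longrightarrow> Ck 3 (\<lambda>th. psi th x (y c))"
    and beta_meas: "beta \<in> borel_measurable nuX"
    and f_meas: "\<And>c. f c \<in> borel_measurable nuX"
    and f_pos: "\<And>c x. x \<in> space nuX \<Longrightarrow> f c x > 0"
    and f_prob: "\<And>c. (\<integral>\<^sup>+ x. ennreal (f c x) \<partial>nuX) = 1"
    and f_form: "\<And>c x. x \<in> space nuX \<Longrightarrow>
                   ln (f c x) = beta x + psi theta0 x (y c) - eps c"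
    and r_pos: "\<And>c. r c > 0"
    and r_sum: "(\<Sum>c\<in>UNIV. r c) = 1"
    and M_prob: "prob_space M"
    and X_indep: "prob_space.indep_vars M (\<lambda>_. nuX) (\<lambda>(c, i). X c i) UNIV"
    and X_distr: "\<And>c i. distributed M nuX (X c i) (\<lambda>x. ennreal (f c x))"
    and N_mono: "strict_mono N"
    and N_int: "\<And>j c. r c * real (N j) \<in> \<nat>"
    and I_posdef: "pos_def (Ibar psi y r P lam0)"
    and mom_grad: "\<And>c. integrable (P c)
                     (\<lambda>x. (norm (grad (\<lambda>l. ln (p_star psi y c x l)) lam0))\<^sup>2)"
    and mom_hess: "\<And>c. integrable (P c)
                     (\<lambda>x. norm (hess (\<lambda>l. ln (p_star psi y c x l)) lam0))"
    and lamhat_meas: "\<And>j. lamhat j \<in> borel_measurable M"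
    and N1: "conv_prob M
               (\<lambda>j \<omega>. (1 / sqrt (real (N j))) *\<^sub>R
                        grad (loglik psi y r X (N j) \<omega>) (lamhat j \<omega>)) 0"
    and N2: "conv_prob M lamhat lam0"
    and N3: "conv_prob M
               (\<lambda>j \<omega>. (1 / real (N j)) *\<^sub>R
                  integral {0..1} (\<lambda>t. J (N j) \<omega> (lam0 + t *\<^sub>R (lamhat j \<omega> - lam0))))
               (Ibar psi y r P lam0)"
  shows "(\<exists>\<mu>. mv_normal \<mu> 0
              (matrix_inv (Ibar psi y r P lam0) ** Sigmabar psi y r P lam0 **
               matrix_inv (Ibar psi y r P lam0)) \<and>
            conv_distr M (\<lambda>j \<omega>. sqrt (real (N j)) *\<^sub>R (lamhat j \<omega> - lam0)) \<mu>) \<and>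
         (\<exists>\<mu>. mv_normal \<mu> 0
              (\<chi> i i'. matrix_inv (Ibar psi y r P lam0) $ Inl i $ Inl i') \<and>
            conv_distr M
              (\<lambda>j \<omega>. sqrt (real (N j)) *\<^sub>R (theta_of (lamhat j \<omega>) - theta0)) \<mu>)"
proof -
  interpret M: prob_space M by fact
  interpret A: association_model nuX y psi theta0 f beta eps r
    by unfold_locales (fact psi_meas psi_C3 f_meas f_pos f_prob f_form r_pos)+
  have P_eq: "A.P = P" by (simp add: A.P_def P_def fun_eq_iff)
  have lam_eq: "A.lam0 = lam0" by (simp add: A.lam0_def lam0_def)
  interpret A: association_model_moments nuX y psi theta0 f beta eps r
    by unfold_locales (simp_all add: A.score_def A.hessian_def P_eq lam_eq mom_grad mom_hess)
  let ?I = "Ibar psi y r P lam0" and ?\<Sigma> = "Sigmabar psi y r P lam0"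
  define C where "C = matrix_inv ?I"
  have sym: "transpose ?I = ?I" using I_posdef by (simp add: pos_def_def)
  note inv = pos_def_invertible[OF I_posdef]
  have symC: "C *v x = x v* C" for x
    using transpose_matrix_vector[of C x] transpose_matrix_inv[OF sym inv] by (simp add: C_def)
  obtain \<mu>0 where \<mu>0: "mv_normal \<mu>0 0 ?\<Sigma>"
    using mv_normal_exists[OF A.Sigmabar_transpose A.Sigmabar_psd] unfolding P_eq lam_eq by blast
  have pr0: "prob_space \<mu>0" "sets \<mu>0 = sets borel" using \<mu>0 by (auto simp: mv_normal_def)
  have Xm: "X c i \<in> measurable M nuX" for c i
    using X_distr[of c i] by (rule distributed_measurable)
  \<comment> \<open>The floor in \<open>ssize\<close> is exact here, as the products
    \<open>r c * N j\<close> are natural numbers; no rounding error enters the centring.\<close>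
  have ss: "real (ssize r (N j) c) = r c * real (N j)" for j c
  proof -
    obtain k where k: "r c * real (N j) = real k" using N_int[of c j] by (auto elim: Nats_cases)
    show ?thesis unfolding ssize_def k by simp
  qed
  define U where "U j \<omega> = (1 / sqrt (real (N j))) *\<^sub>R
    (\<Sum>c\<in>UNIV. \<Sum>i<ssize r (N j) c. A.score c (X c i \<omega>))" for j \<omega>
  have U: "conv_distr M U \<mu>0"
    unfolding U_def
  proof (rule M.stratified_central_limit_theorem[where r=r and P=P])
    show "M.indep_vars (\<lambda>_. nuX) (\<lambda>(c, i). X c i) UNIV" by (rule X_indep)
    show "distr M nuX (X c i) = P c" for c i
      using distributed_distr_eq_density[OF X_distr] by (simp add: P_def)
    show "mv_normal \<mu>0 0 (\<Sum>c\<in>UNIV. r c *\<^sub>R covmat (P c) (A.score c))"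
      using \<mu>0 by (simp add: Sigmabar_def A.score_def[abs_def] lam_eq)
  qed (use A.score_sq A.mean_score_centered r_pos N_mono ss in \<open>simp_all add: P_eq\<close>)
  define W where "W j \<omega> = sqrt (real (N j)) *\<^sub>R (lamhat j \<omega> - lam0)" for j \<omega>
  have [measurable]: "lamhat j \<in> borel_measurable M" for j by (rule lamhat_meas)
  have W: "W j \<in> borel_measurable M" for j unfolding W_def by measurable
  \<comment> \<open>(N3) supplies the convergent random matrix and (N1) the negligible right-hand
    side of the linear equation.\<close>
  have lin: "conv_prob M (\<lambda>j \<omega>. W j \<omega> - C *v U j \<omega>) 0"
    unfolding C_def
  proof (rule estimating_equation_linearization[OF M.prob_space_axioms W _ _ sym inv N3 N1])
    show "U j \<in> borel_measurable M" for j using U by (simp add: conv_distr_def)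
    show "tight_seq M U" by (rule conv_distr_imp_tight[OF M.prob_space_axioms pr0 U])
    fix j \<omega> assume \<omega>: "\<omega> \<in> space M"
    define n where "n = N j"
    define l where "l = loglik psi y r X n \<omega>"
    have Xs: "X c i \<omega> \<in> space nuX" for c i using measurable_space[OF Xm \<omega>] .
    have l_eq: "l = (\<lambda>lam. \<Sum>c\<in>UNIV. \<Sum>i<ssize r n c. ln (p_star psi y c (X c i \<omega>) lam))"
      by (simp add: l_def loglik_def fun_eq_iff)
    have l_C2: "Ck 2 l" unfolding l_eq by (intro Ck_sum A.Ck_log_p_star Xs)
    have grad_l: "grad l lam0 = (\<Sum>c\<in>UNIV. \<Sum>i<ssize r n c. A.score c (X c i \<omega>))"
    proof -
      have D: "(\<lambda>lam. ln (p_star psi y c (X c i \<omega>) lam)) differentiable (at lam0)" for c i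
        by (rule Ck_2_grad(1)[OF A.Ck_log_p_star[OF Xs]])
      have "grad l lam0 = (\<Sum>c\<in>UNIV. grad (\<lambda>lam. \<Sum>i<ssize r n c. ln (p_star psi y c (X c i \<omega>) lam)) lam0)"
        unfolding l_eq by (intro grad_sum differentiable_sum finite_lessThan ballI D)
      also have "\<dots> = (\<Sum>c\<in>UNIV. \<Sum>i<ssize r n c. A.score c (X c i \<omega>))"
        by (intro sum.cong refl) (simp add: grad_sum[OF D] A.score_def lam_eq)
      finally show ?thesis .
    qed
    define d where "d = lamhat j \<omega> - lam0"
    define H where "H = integral {0..1} (\<lambda>t. hess l (lam0 + t *\<^sub>R d))"
    have g: "grad l (lamhat j \<omega>) = grad l lam0 + d v* H"
      unfolding d_def H_def by (rule grad_integral_hess[OF l_C2])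
    have J_H: "integral {0..1} (\<lambda>t. J n \<omega> (lam0 + t *\<^sub>R d)) = - H"
      by (simp add: J_def H_def l_def integral_neg)
    \<comment> \<open>A strictly increasing \<open>N\<close> may start at 0; there both sides are 0
      by the convention for division.\<close>
    have "sqrt (real n) * (1 / real n) = 1 / sqrt (real n)"
      by (cases "n = 0") (simp_all add: field_simps)
    moreover have "(a *\<^sub>R d) v* (b *\<^sub>R (- H)) = - ((a * b) *\<^sub>R (d v* H))" for a b
      by (simp add: vec_eq_iff vector_matrix_mult_def sum_distrib_left sum_negf mult_ac)
    ultimately have scaled: "(sqrt (real n) *\<^sub>R d) v* ((1 / real n) *\<^sub>R (- H)) = - ((1 / sqrt (real n)) *\<^sub>R (d v* H))"
      by (simp only:)
    show "U j \<omega> - W j \<omega> v* ((1 / real (N j)) *\<^sub>R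
        integral {0..1} (\<lambda>t. J (N j) \<omega> (lam0 + t *\<^sub>R (lamhat j \<omega> - lam0)))) =
      (1 / sqrt (real (N j))) *\<^sub>R grad (loglik psi y r X (N j) \<omega>) (lamhat j \<omega>)"
      unfolding n_def[symmetric] d_def[symmetric] l_def[symmetric] g J_H W_def scaled U_def grad_l
      by (simp add: scaleR_add_right)
  qed
  let ?\<mu> = "distr \<mu>0 borel ((*v) C)"
  have contC: "continuous_on UNIV ((*v) C)"
    by (rule linear_continuous_on[OF matrix_vector_mul_bounded_linear])
  have \<mu>: "mv_normal ?\<mu> 0 (C ** ?\<Sigma> ** C)"
  proof (rule mv_normal_linear_image[OF \<mu>0 borel_measurable_continuous_onI[OF contC]])
    \<comment> \<open>\<open>C\<close> is its own adjoint, being the inverse of a symmetric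
      matrix.\<close>
    show "t \<bullet> (C *v x) = (C *v t) \<bullet> x" for t x
      by (simp add: symC[of t] dot_lmul_matrix)
    show "t \<bullet> ((C ** ?\<Sigma> ** C) *v t) = (C *v t) \<bullet> (?\<Sigma> *v (C *v t))" for t
      by (simp add: symC[of t] dot_lmul_matrix matrix_vector_mul_assoc matrix_mul_assoc)
        (simp add: symC[symmetric] matrix_vector_mul_assoc matrix_mul_assoc)
  qed
  have pr: "prob_space ?\<mu>" "sets ?\<mu> = sets borel" using \<mu> by (auto simp: mv_normal_def)
  have W_conv: "conv_distr M W ?\<mu>"
    by (rule slutsky[OF M.prob_space_axioms pr conv_distr_continuous_image[OF U pr0(2) contC] lin])
  have cont_th: "continuous_on UNIV (theta_of :: real^('s + 'k) \<Rightarrow> real^'s)"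
    by (rule linear_continuous_on[OF bounded_linear_theta_of])
  have "mv_normal (distr ?\<mu> borel theta_of) 0 (\<chi> i i'. C $ Inl i $ Inl i')"
  proof (rule mv_normal_linear_image[OF \<mu> borel_measurable_continuous_onI[OF cont_th]])
    show "t \<bullet> theta_of x = mk_lam t (\<lambda>_. 0) \<bullet> x" for t and x :: "real^('s + 'k)"
      by (simp add: inner_mk_lam_0)
    show "t \<bullet> ((\<chi> i i'. C $ Inl i $ Inl i') *v t) =
        mk_lam t (\<lambda>_. 0) \<bullet> ((C ** ?\<Sigma> ** C) *v mk_lam t (\<lambda>_. 0))" for t
      using A.sandwich_theta_block[of t] I_posdef unfolding P_eq lam_eq C_def by blast
  qed
  moreover have "theta_of (W j \<omega>) = sqrt (real (N j)) *\<^sub>R (theta_of (lamhat j \<omega>) - theta0)" for j \<omega>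
    by (simp add: W_def theta_of_def lam0_def mk_lam_def vec_eq_iff)
  then have "conv_distr M (\<lambda>j \<omega>. sqrt (real (N j)) *\<^sub>R (theta_of (lamhat j \<omega>) - theta0))
      (distr ?\<mu> borel theta_of)"
    using conv_distr_continuous_image[OF W_conv pr(2) cont_th] by simp
  moreover have "conv_distr M (\<lambda>j \<omega>. sqrt (real (N j)) *\<^sub>R (lamhat j \<omega> - lam0)) ?\<mu>"
    using W_conv by (simp add: W_def[abs_def])
  ultimately show ?thesis using \<mu> unfolding C_def by blast
qed

end
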